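(* Let $A,B$ be multiplicative characters of $\mathbb{F}_q$ such that $A^2$, $B^2$, $A\overline{B}\varphi$, $AB$, $AB\varphi$ are all different from $\varepsilon$. Then for every $x\in\mathbb{F}_q$ with $x\neq1$ and $x\neq\frac12$, \begin{align*} {}_2F_1(A,B;\,AB\varphi\mid 4x(1-x))^2&=\frac{AB(4)\,g(B)^2g(A\varphi)^2}{q\,g(A^2)\,g(B^2)}\,{}_3F_2(A^2,B^2,AB;\,A^2B^2,AB\varphi\mid 4x(1-x))\\ &\quad+\frac{g(B)^2g(A\varphi)^2\,(\overline{A}\,\overline{B}\varphi)(x-x^2)}{q^2\,g(A^2)\,g(B^2)}. \end{align*}
   Context: Let $p$ be an odd prime, $q=p^r$, and $\mathbb{F}_q$ the field with $q$ elements. Multiplicative characters of $\mathbb{F}_q^\times$ are extended to $\mathbb{F}_q$ by $\chi(0)=0$ (including the trivial character $\varepsilon$). $\varphi$ is the quadratic character. Characters are multiplied pointwise, $\overline{A}$ is the inverse of $A$, and e.g. $(\overline{A}\,\overline{B}\varphi)(x-x^2)$ means the product character evaluated at $x-x^2$. The Gauss sum is $g(\chi)=\sum_{x\in\mathbb{F}_q}\chi(x)\theta(x)$ with $\theta(\alpha)=\zeta_p^{\mathrm{tr}(\alpha)}$, $\zeta_p$ a fixed primitive $p$-th root of unity, $\mathrm{tr}$ the trace to $\mathbb{F}_p$. The binomial coefficient is $\binom{A}{B}=\frac{B(-1)}{q}\sum_{x\in\mathbb{F}_q}A(x)\overline{B}(1-x)$. Greene's series: ${}_{n+1}F_n(A_0,\dots,A_n;\,B_1,\dots,B_n\mid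 x)=\frac{q}{q-1}\sum_{\chi}\binom{A_0\chi}{\chi}\prod_{i=1}^n\binom{A_i\chi}{B_i\chi}\chi(x)$, summed over all multiplicative characters $\chi$. *)

theory Defs
  imports
    Complex_Main
    "HOL-Library.Cardinality"
    "HOL-Library.Function_Division"
    "HOL-Computational_Algebra.Primes"
begin

text \<open>
  The field with \<open>q\<close> elements is a type \<open>'a\<close> of class \<open>{finite, field}\<close> with \<open>CARD('a) = q\<close>.
  Characters are functions \<open>'a \<Rightarrow> complex\<close>. Their products, powers with positive exponent and
  inverses are the pointwise ones from \<^theory>\<open>HOL-Library.Function_Division\<close>; since
  \<open>inverse 0 = 0\<close>, the pointwise inverse of a character again vanishes at \<open>0\<close>. The neutral
  element for characters is \<open>triv_char\<close>, not the constant function \<open>1\<close> of that theory.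
\<close>

definition mult_char :: "('a::field \<Rightarrow> complex) \<Rightarrow> bool" where
  "mult_char \<chi> \<longleftrightarrow> \<chi> 0 = 0 \<and> \<chi> 1 = 1 \<and> (\<forall>x y. \<chi> (x * y) = \<chi> x * \<chi> y)"

definition triv_char :: "'a::field \<Rightarrow> complex" where
  "triv_char x = (if x = 0 then 0 else 1)"

definition quad_char :: "'a::field \<Rightarrow> complex" where
  "quad_char x = (if x = 0 then 0 else if \<exists>y. x = y\<^sup>2 then 1 else -1)"

definition primitive_root_of_unity :: "nat \<Rightarrow> complex \<Rightarrow> bool" where
  "primitive_root_of_unity n z \<longleftrightarrow> n > 0 \<and> z ^ n = 1 \<and> (\<forall>k. 0 < k \<and> k < n \<longrightarrow> z ^ k \<noteq> 1)"

text \<open>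
  The trace from the field with \<open>p ^ r\<close> elements to its prime field, as the sum of the
  conjugates under the Frobenius map; its value is an element of the prime field inside \<open>'a\<close>.
\<close>

definition trace_prime :: "nat \<Rightarrow> nat \<Rightarrow> 'a::field \<Rightarrow> 'a" where
  "trace_prime p r \<alpha> = (\<Sum>i<r. \<alpha> ^ (p ^ i))"

text \<open>
  The exponent of \<open>\<zeta>\<close> is the representative in \<open>{0..<p}\<close> of the trace.
\<close>

definition add_char :: "nat \<Rightarrow> nat \<Rightarrow> complex \<Rightarrow> 'a::field \<Rightarrow> complex" where
  "add_char p r \<zeta> \<alpha> = \<zeta> ^ (THE n. n < p \<and> of_nat n = trace_prime p r \<alpha>)"

definition gauss_sum ::
    "nat \<Rightarrow> nat \<Rightarrow> complex \<Rightarrow> ('a::{finite, field} \<Rightarrow> complex) \<Rightarrow> complex" where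
  "gauss_sum p r \<zeta> \<chi> = (\<Sum>x\<in>UNIV. \<chi> x * add_char p r \<zeta> x)"

definition char_binom ::
    "('a::{finite, field} \<Rightarrow> complex) \<Rightarrow> ('a \<Rightarrow> complex) \<Rightarrow> complex" where
  "char_binom A B = B (-1) / of_nat CARD('a) * (\<Sum>x\<in>UNIV. A x * (inverse B) (1 - x))"

text \<open>
  Greene's series with upper parameters \<open>As = [A\<^sub>0, \<dots>, A\<^sub>n]\<close> and lower parameters
  \<open>Bs = [B\<^sub>1, \<dots>, B\<^sub>n]\<close>, so that \<open>B\<^sub>i\<close> is \<open>Bs ! (i - 1)\<close>; only meaningful if
  \<open>length As = length Bs + 1\<close>.
\<close>

definition greene_F ::
    "('a::{finite, field} \<Rightarrow> complex) list \<Rightarrow> ('a \<Rightarrow> complex) list \<Rightarrow> 'a \<Rightarrow> complex" where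
  "greene_F As Bs x =
     of_nat CARD('a) / (of_nat CARD('a) - 1) *
     (\<Sum>\<chi> | mult_char \<chi>.
        char_binom (As ! 0 * \<chi>) \<chi> *
        (\<Prod>i = 1..length Bs. char_binom (As ! i * \<chi>) (Bs ! (i - 1) * \<chi>)) * \<chi> x)"

text \<open>The index set of the sum above is finite, so the sum has its intended value.\<close>

lemma finite_mult_chars: "finite {\<chi> :: 'a::{finite, field} \<Rightarrow> complex. mult_char \<chi>}"
proof -
  define S :: "complex set" where "S = insert 0 (\<Union>n\<in>{1..CARD('a)}. {z. z ^ n = 1})"
  have "finite S"
    unfolding S_def using finite_roots_unity by (auto intro!: finite_roots_unity)
  then have "finite {f :: 'a \<Rightarrow> complex. \<forall>x. f x \<in> S}"
    using finite_set_of_finite_funs[of "UNIV :: 'a set" S] by simp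
  moreover have "\<chi> x \<in> S" if "mult_char \<chi>" for \<chi> :: "'a \<Rightarrow> complex" and x
  proof (cases "x = 0")
    case True
    with that show ?thesis by (simp add: S_def mult_char_def)
  next
    case False
    have pow: "\<chi> (x ^ n) = \<chi> x ^ n" for n
      using that by (induction n) (simp_all add: mult_char_def)
    have "\<not> inj_on (\<lambda>n. x ^ n) {0..CARD('a)}"
    proof
      assume "inj_on (\<lambda>n. x ^ n) {0..CARD('a)}"
      then have "card {0..CARD('a)} \<le> CARD('a)"
        by (rule card_inj_on_le) auto
      then show False by simp
    qed
    then obtain i j where ij: "i < j" "j \<le> CARD('a)" "x ^ i = x ^ j"
      unfolding inj_on_def by (metis atLeastAtMost_iff linorder_neqE_nat)
    have "x ^ i * x ^ (j - i) = x ^ i * 1"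
      using ij by (metis less_imp_le mult.right_neutral power_add le_add_diff_inverse)
    then have "x ^ (j - i) = 1"
      using False by simp
    then have "\<chi> x ^ (j - i) = 1"
      using pow[of "j - i"] that by (simp add: mult_char_def)
    moreover have "j - i \<in> {1..CARD('a)}"
      using ij by auto
    ultimately show ?thesis
      unfolding S_def by blast
  qed
  ultimately show ?thesis
    by (auto elim!: finite_subset[rotated])
qed

end

theory Submission
  imports Defs "HOL-Number_Theory.Residues" "HOL-Computational_Algebra.Polynomial"
begin

text \<open>
  Put \<open>c = 1 - 2 x\<close> and \<open>u = 1 - c\<^sup>2 = 4 x (1 - x)\<close>. As over the complex numbers, Clausen's formula is
  the diagonal case of the product formula for Gegenbauer functions, here
  \<open>P A B c = (\<Sum>r. A\<^sup>2(r) / (A B)(1 - 2 c r + r\<^sup>2))\<close>. Expanding \<open>1 / (A B)\<close> by a Gauss sum and evaluating a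
  quadratic exponential sum backwards (Salie) turns \<open>P A B c\<close> into a symmetric Kloosterman-type
  sum in three variables, which also equals the Euler integral of the \<open>\<^sub>2F\<^sub>1\<close> up to Gauss sums.
  A Moebius substitution in that integral shows that \<open>P A B c\<close> is, up to \<open>\<phi>(u) / (A B)(u)\<close> and
  constants, equal to \<open>P (1/A) (1/B) c\<close>, so the square of the \<open>\<^sub>2F\<^sub>1\<close> becomes a multiple of the product
  \<open>P A B c * P (1/A) (1/B) c\<close>. Counting the solutions \<open>s\<close> of
  \<open>1 - 2 c s + s\<^sup>2 = k (1 - 2 c t s + t\<^sup>2 s\<^sup>2)\<close> writes this product as a double sum over \<open>t\<close> and \<open>k\<close>,
  and a birational change of variables transforms it into the integral of the \<open>\<^sub>3F\<^sub>2\<close>; the term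
  \<open>t = k = 1\<close> produces the extra summand.
\<close>

section \<open>Multiplicative characters of a finite field\<close>

text \<open>Multiplying a Gegenbauer sum by itself would combine two of its quadratic polynomials
  into a product. Against the sum for the inverse characters they enter as a quotient instead:
  fixing its value \<open>k\<close> is a single quadratic equation in \<open>s\<close>, whose number
  of solutions is \<open>1 + \<phi>\<close> of a discriminant apart from degenerate cases. This is
  the purpose of the Moebius step, and the discriminant is the origin of the factor
  \<open>\<phi> (1 - y)\<close> in the integral of the \<open>\<^sub>3F\<^sub>2\<close>. The change
  of variables is only birational, so everything hinges on the terms it does not reach. They
  contribute \<open>- 2 - \<phi> (- u)\<close> to either double sum and therefore cancel. The
  constants come from the duplication formula: it turns \<open>G A * G (A * \<phi>)\<close> and its
  counterpart for \<open>B\<close> into \<open>G (A\<^sup>2)\<close>, \<open>G (B\<^sup>2)\<close>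
  and the value of \<open>A * B\<close> at 4.\<close>

lemma mult_char_0: "mult_char \<chi> \<Longrightarrow> \<chi> 0 = 0"
  and mult_char_1: "mult_char \<chi> \<Longrightarrow> \<chi> 1 = 1"
  and mult_char_mult: "mult_char \<chi> \<Longrightarrow> \<chi> (x * y) = \<chi> x * \<chi> y"
  by (auto simp: mult_char_def)

lemma mult_char_eq_0_iff:
  assumes "mult_char \<chi>"
  shows "\<chi> x = 0 \<longleftrightarrow> x = 0"
proof
  assume "\<chi> x = 0"
  then show "x = 0"
    using mult_char_mult[OF assms, of x "inverse x"] mult_char_1[OF assms] by (cases "x = 0") auto
qed (use assms in \<open>simp add: mult_char_0\<close>)

lemma mult_char_inverse:
  assumes "mult_char \<chi>"
  shows "\<chi> (inverse x) = inverse (\<chi> x)"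
  using mult_char_mult[OF assms, of x "inverse x"] mult_char_1[OF assms] mult_char_0[OF assms]
  by (cases "x = 0") (auto simp: inverse_unique)

lemma mult_char_divide: "mult_char \<chi> \<Longrightarrow> \<chi> (x / y) = \<chi> x / \<chi> y"
  by (simp add: divide_inverse mult_char_mult mult_char_inverse)

lemma mult_char_power: "mult_char \<chi> \<Longrightarrow> \<chi> (x ^ n) = \<chi> x ^ n"
  by (induction n) (simp_all add: mult_char_def)

lemma mult_char_neg_1_squared: "mult_char \<chi> \<Longrightarrow> \<chi> (-1) * \<chi> (-1) = 1"
  by (metis minus_mult_minus mult_1 mult_char_1 mult_char_mult)

lemma mult_char_minus: "mult_char \<chi> \<Longrightarrow> \<chi> (- x) = \<chi> (-1) * \<chi> x"
  by (metis mult_char_mult mult_minus1)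

lemma power2_fun_apply [simp]: "(f\<^sup>2) x = (f x)\<^sup>2" for f :: "'b \<Rightarrow> 'c::comm_semiring_1"
  by (simp add: power2_eq_square)

lemma mult_char_times [simp]: "mult_char \<chi> \<Longrightarrow> mult_char \<psi> \<Longrightarrow> mult_char (\<chi> * \<psi>)"
  by (simp add: mult_char_def)

lemma mult_char_inverse_fun [simp]: "mult_char \<chi> \<Longrightarrow> mult_char (inverse \<chi>)"
  by (simp add: mult_char_def)

lemma mult_char_power2 [simp]: "mult_char \<chi> \<Longrightarrow> mult_char (\<chi>\<^sup>2)"
  by (simp add: power2_eq_square)

lemma mult_char_triv [simp]: "mult_char triv_char"
  by (simp add: mult_char_def triv_char_def)

lemma mult_char_times_inverse: "mult_char \<chi> \<Longrightarrow> \<chi> * inverse \<chi> = triv_char"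
  by (rule ext) (simp add: triv_char_def mult_char_eq_0_iff)

lemma triv_char_times: "mult_char \<chi> \<Longrightarrow> triv_char * \<chi> = \<chi>"
  by (rule ext) (simp add: triv_char_def mult_char_0)

lemma mult_char_nontriv:
  assumes "mult_char \<chi>" "\<chi> \<noteq> triv_char"
  obtains a where "a \<noteq> 0" "\<chi> a \<noteq> 1"
  using assms mult_char_0[OF assms(1)] by (auto simp: fun_eq_iff triv_char_def split: if_splits)

lemma sum_mult_char:
  fixes \<chi> :: "'a::{finite, field} \<Rightarrow> complex"
  assumes "mult_char \<chi>" "\<chi> \<noteq> triv_char"
  shows "(\<Sum>x\<in>UNIV. \<chi> x) = 0"
proof -
  obtain a where a: "a \<noteq> 0" "\<chi> a \<noteq> 1"
    using mult_char_nontriv assms by blast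
  have "(\<Sum>x\<in>UNIV. \<chi> x) = (\<Sum>x\<in>UNIV. \<chi> (a * x))"
    by (rule sum.reindex_bij_witness[of _ "\<lambda>x. a * x" "\<lambda>x. x / a"]) (use a in auto)
  also have "\<dots> = \<chi> a * (\<Sum>x\<in>UNIV. \<chi> x)"
    by (simp add: mult_char_mult[OF assms(1)] sum_distrib_left)
  finally show ?thesis
    using a by simp
qed

lemma inverse_triv_char [simp]: "inverse \<chi> = triv_char \<longleftrightarrow> \<chi> = triv_char"
  by (simp add: fun_eq_iff triv_char_def)

lemma sum_triv_char: "(\<Sum>x\<in>(UNIV :: 'a::{finite, field} set). triv_char x) = of_nat CARD('a) - 1"
proof -
  have "(\<Sum>x\<in>(UNIV :: 'a set). triv_char x) = (\<Sum>x\<in>UNIV - {0 :: 'a}. 1)"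
    by (rule sum.mono_neutral_cong_right) (auto simp: triv_char_def)
  then show ?thesis
    by (simp add: card_Diff_singleton)
qed

section \<open>The cyclic multiplicative group and the orthogonality relations\<close>

lemma finite_field_generator:
  obtains g :: "'a::{finite, field}"
  where "g \<noteq> 0" and "\<And>x. x \<noteq> 0 \<Longrightarrow> \<exists>i. x = g ^ i"
proof -
  \<comment> \<open>The type packed as a ring record, the form in which the cyclicity of the
    multiplicative group is stated.\<close>
  define R where
    "R = \<lparr>carrier = (UNIV :: 'a set), monoid.mult = (*) :: 'a \<Rightarrow> 'a \<Rightarrow> 'a, one = 1 :: 'a, ring.zero = 0 :: 'a, add = (+)\<rparr>"
  have cring: "cring R"
    unfolding R_def
    by (rule cringI, rule abelian_groupI)
       (auto simp: algebra_simps comm_monoid_def monoid_def comm_monoid_axioms_def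
        intro!: exI[of _ "- x" for x] intro: add.left_inverse)
  have field: "field R"
    by (rule cring.cring_fieldI2[OF cring])
       (auto simp: R_def intro!: exI[of _ "inverse a" for a] right_inverse)
  then interpret field R .
  have pow: "g [^]\<^bsub>R\<^esub> i = g ^ i" for g and i :: nat
    by (induction i) (simp_all add: nat_pow_def R_def mult.commute)
  have "carrier (mult_of R) = UNIV - {0}"
    by (simp add: carrier_mult_of) (simp add: R_def)
  with finite_field_mult_group_has_gen obtain g
    where "g \<noteq> 0" "UNIV - {0} = {g [^]\<^bsub>R\<^esub> i | i :: nat. i \<in> UNIV}"
    by (auto simp: R_def)
  then show thesis
    by (intro that[of g]) (auto simp: pow)
qed

lemma card_field_gt_1: "CARD('a::{finite, field}) > 1"
proof -
  have "card {0, 1 :: 'a} \<le> CARD('a)"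
    by (rule card_mono) auto
  then show ?thesis by simp
qed

lemma finite_field_power_card_minus_1:
  fixes x :: "'a::{finite, field}"
  assumes "x \<noteq> 0"
  shows "x ^ (CARD('a) - 1) = 1"
proof -
  have 1: "(\<Prod>y\<in>UNIV - {0}. x * y) = (\<Prod>y\<in>UNIV - {0}. y)"
    by (rule prod.reindex_bij_witness[of _ "\<lambda>y. y / x" "\<lambda>y. x * y"]) (use assms in auto)
  have 2: "x ^ card (UNIV - {0 :: 'a}) * (\<Prod>y\<in>UNIV - {0}. y) = 1 * (\<Prod>y\<in>UNIV - {0}. y)"
    using 1 by (simp only: prod.distrib prod_constant mult_1)
  have 3: "(\<Prod>y\<in>UNIV - {0 :: 'a}. y) \<noteq> 0"
    unfolding prod_zero_iff[OF finite] by blast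
  have 4: "x ^ card (UNIV - {0 :: 'a}) = 1"
    using 2 unfolding mult_right_cancel[OF 3] .
  moreover have "card (UNIV - {0 :: 'a}) = CARD('a) - 1"
    by (rule card_Diff_singleton) (rule UNIV_I)
  ultimately show ?thesis
    by (simp only:)
qed

text \<open>With \<open>n = CARD('a) - 1\<close>, the \<open>n\<close> residues of the exponent
  reach all \<open>n\<close> units, so no two of them can give the same unit.\<close>

lemma generator_power_eq_iff:
  fixes g :: "'a::{finite, field}"
  assumes g: "g \<noteq> 0" "\<And>x. x \<noteq> 0 \<Longrightarrow> \<exists>i. x = g ^ i"
  shows "g ^ i = g ^ j \<longleftrightarrow> i mod (CARD('a) - 1) = j mod (CARD('a) - 1)"
proof -
  define n where "n = CARD('a) - 1"
  have n: "n > 0"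
    using card_field_gt_1[where 'a = 'a] by (simp add: n_def)
  have mod: "g ^ i = g ^ (i mod n)" for i
  proof -
    have "g ^ i = (g ^ n) ^ (i div n) * g ^ (i mod n)"
      by (simp flip: power_add power_mult)
    then show ?thesis
      using finite_field_power_card_minus_1[OF g(1)] by (simp add: n_def)
  qed
  have "UNIV - {0} \<subseteq> (\<lambda>i. g ^ i) ` {..<n}"
  proof
    fix x :: 'a
    assume "x \<in> UNIV - {0}"
    then obtain i where "x = g ^ i"
      using g(2) by auto
    then have "x = g ^ (i mod n)"
      using mod by simp
    then show "x \<in> (\<lambda>i. g ^ i) ` {..<n}"
      using n by auto
  qed
  moreover have "(\<lambda>i. g ^ i) ` {..<n} \<subseteq> UNIV - {0}"
    using g(1) by auto
  ultimately have "(\<lambda>i. g ^ i) ` {..<n} = UNIV - {0}" by blast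
  then have "inj_on (\<lambda>i. g ^ i) {..<n}"
    by (intro eq_card_imp_inj_on) (auto simp: card_Diff_singleton n_def)
  then have "g ^ (i mod n) = g ^ (j mod n) \<longleftrightarrow> i mod n = j mod n"
    using n by (auto dest: inj_onD)
  then show ?thesis
    using mod by (simp add: n_def)
qed

text \<open>A generator is sent to a primitive root of unity of order \<open>CARD('a) - 1\<close>.
  The resulting character is injective on the units, so one character serves every
  \<open>a\<close>.\<close>

lemma mult_char_separates:
  fixes a :: "'a::{finite, field}"
  assumes "a \<noteq> 0" "a \<noteq> 1"
  obtains \<chi> where "mult_char \<chi>" "\<chi> a \<noteq> 1"
proof -
  obtain g :: 'a where g: "g \<noteq> 0" "\<And>x. x \<noteq> 0 \<Longrightarrow> \<exists>i. x = g ^ i"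
    using finite_field_generator by blast
  define n where "n = CARD('a) - 1"
  have n: "n > 0"
    using card_field_gt_1[where 'a = 'a] by (simp add: n_def)
  define \<omega> where "\<omega> = cis (2 * pi / n)"
  have \<omega>n: "\<omega> ^ n = 1"
    using n by (simp add: \<omega>_def DeMoivre)
  have \<omega>_mod: "\<omega> ^ (i mod n) = \<omega> ^ i" for i
  proof -
    have "\<omega> ^ i = (\<omega> ^ n) ^ (i div n) * \<omega> ^ (i mod n)"
      by (simp flip: power_add power_mult)
    then show ?thesis
      by (simp add: \<omega>n)
  qed
  have inj: "inj_on (\<lambda>i. \<omega> ^ i) {..<n}"
    using inj_on_subset[OF bij_betw_imp_inj_on[OF bij_betw_roots_unity[OF n]]]
    by (simp add: \<omega>_def DeMoivre mult_ac)
  \<comment> \<open>The discrete logarithm picked by \<open>SOME\<close> is determined only modulo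
    \<open>n\<close>, which is enough because \<open>\<omega> ^ n = 1\<close>.\<close>
  define \<chi> where "\<chi> x = (if x = 0 then 0 else \<omega> ^ (SOME i. x = g ^ i))" for x :: 'a
  have \<chi>_g: "\<chi> (g ^ i) = \<omega> ^ i" for i
  proof -
    have "g ^ i = g ^ (SOME j. g ^ i = g ^ j)"
      by (rule someI[of "\<lambda>j. g ^ i = g ^ j"]) simp
    then have "i mod n = (SOME j. g ^ i = g ^ j) mod n"
      using generator_power_eq_iff[OF g] by (simp add: n_def)
    then show ?thesis
      using g(1) \<omega>_mod by (simp add: \<chi>_def) metis
  qed
  have "\<chi> (x * y) = \<chi> x * \<chi> y" for x y
  proof (cases "x = 0 \<or> y = 0")
    case False
    then obtain i j where "x = g ^ i" "y = g ^ j"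
      using g(2) by metis
    then show ?thesis
      by (simp add: \<chi>_g flip: power_add)
  qed (auto simp: \<chi>_def)
  then have "mult_char \<chi>"
    using \<chi>_g[of 0] by (simp add: mult_char_def) (simp add: \<chi>_def)
  moreover have "\<chi> a \<noteq> 1"
  proof
    assume *: "\<chi> a = 1"
    obtain i where i: "a = g ^ i"
      using g(2) assms(1) by metis
    then have "\<omega> ^ (i mod n) = \<omega> ^ 0"
      using * by (simp add: \<chi>_g \<omega>_mod)
    then have "i mod n = 0"
      using inj_onD[OF inj, of "i mod n" 0] n by simp
    then have "g ^ i = g ^ 0"
      using generator_power_eq_iff[OF g, of i 0] by (simp add: n_def)
    then show False
      using i assms(2) by simp
  qed
  ultimately show thesis
    using that by blast
qed

text \<open>Multiplying all characters by a \<open>\<psi>\<close> with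
  \<open>\<psi> a \<noteq> 1\<close> permutes them and multiplies the sum by
  \<open>\<psi> a\<close>.\<close>

lemma sum_over_mult_chars_neq_1:
  fixes a :: "'a::{finite, field}"
  assumes "a \<noteq> 1"
  shows "(\<Sum>\<chi> | mult_char \<chi>. \<chi> a) = 0"
proof (cases "a = 0")
  case False
  then obtain \<psi> where \<psi>: "mult_char \<psi>" "\<psi> a \<noteq> 1"
    using mult_char_separates assms by metis
  have inv: "\<psi> * (inverse \<psi> * \<chi>) = \<chi>" "inverse \<psi> * (\<psi> * \<chi>) = \<chi>" if "mult_char \<chi>" for \<chi>
    using mult_char_times_inverse[OF \<psi>(1)] triv_char_times[OF that]
    by (metis mult.assoc mult.commute)+
  have "(\<Sum>\<chi> | mult_char \<chi>. \<chi> a) = (\<Sum>\<chi> | mult_char \<chi>. (\<psi> * \<chi>) a)"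
    by (rule sum.reindex_bij_witness[of _ "\<lambda>\<chi>. \<psi> * \<chi>" "\<lambda>\<chi>. inverse \<psi> * \<chi>"])
       (use \<psi>(1) inv in simp_all)
  also have "\<dots> = \<psi> a * (\<Sum>\<chi> | mult_char \<chi>. \<chi> a)"
    by (simp add: sum_distrib_left)
  finally show ?thesis
    using \<psi>(2) by simp
qed (simp add: mult_char_0)

text \<open>The double sum of \<open>\<chi> a\<close> is evaluated in both orders: summing over
  \<open>\<chi>\<close> first leaves only \<open>a = 1\<close>, summing over \<open>a\<close> first
  leaves only the trivial character.\<close>

lemma card_mult_chars:
  "of_nat (card {\<chi> :: 'a::{finite, field} \<Rightarrow> complex. mult_char \<chi>}) = (of_nat CARD('a) - 1 :: complex)"
proof -
  let ?M = "{\<chi> :: 'a \<Rightarrow> complex. mult_char \<chi>}"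
  have "(\<Sum>a\<in>UNIV. \<Sum>\<chi>\<in>?M. \<chi> a) = (\<Sum>a\<in>(UNIV :: 'a set). if a = 1 then of_nat (card ?M) else 0)"
    by (rule sum.cong[OF refl]) (simp add: sum_over_mult_chars_neq_1 mult_char_1)
  also have "\<dots> = of_nat (card ?M)"
    by simp
  finally have "of_nat (card ?M) = (\<Sum>\<chi>\<in>?M. \<Sum>a\<in>UNIV. \<chi> a)"
    by (subst sum.swap) simp
  also have "\<dots> = (\<Sum>\<chi>\<in>?M. if \<chi> = triv_char then of_nat CARD('a) - 1 else 0)"
    by (rule sum.cong) (auto simp: sum_mult_char sum_triv_char)
  also have "\<dots> = of_nat CARD('a) - 1"
    by (simp add: finite_mult_chars)
  finally show ?thesis .
qed

lemma sum_over_mult_chars: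
  "(\<Sum>\<chi> | mult_char \<chi>. \<chi> (a :: 'a::{finite, field})) = (if a = 1 then of_nat CARD('a) - 1 else 0)"
  by (simp add: sum_over_mult_chars_neq_1 card_mult_chars mult_char_1)

section \<open>Character sum representations of Greene's series\<close>

text \<open>In the definition \<open>\<chi>\<close> occurs at \<open>x\<close> and, inverted, at
  \<open>1 - x\<close>. The substitution \<open>x = y / (y - 1)\<close> makes
  \<open>x / (1 - x) = - y\<close>, so a single factor \<open>\<chi> y\<close> remains. The binomial
  becomes a Mellin transform, which lets a sum over all \<open>\<chi>\<close> collapse.\<close>

lemma char_binom_times:
  fixes A B \<chi> :: "'a::{finite, field} \<Rightarrow> complex"
  assumes A: "mult_char A" and B: "mult_char B" and \<chi>: "mult_char \<chi>"
  shows "char_binom (A * \<chi>) (B * \<chi>) =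
    (A * B) (-1) / of_nat CARD('a) * (\<Sum>y\<in>UNIV. A y * (inverse A * B) (1 - y) * \<chi> y)"
proof -
  note 0 = mult_char_0[OF A] mult_char_0[OF B] mult_char_0[OF \<chi>]
  have "(\<Sum>x\<in>UNIV. (A * \<chi>) x * inverse (B * \<chi>) (1 - x)) =
      (\<Sum>x\<in>-{1}. (A * \<chi>) x * inverse (B * \<chi>) (1 - x))"
    by (rule sum.mono_neutral_right) (use 0 in auto)
  also have "\<dots> = (\<Sum>y\<in>-{1}. (A * \<chi>) (-1) * (A y * (inverse A * B) (1 - y) * \<chi> y))"
  proof (rule sum.reindex_bij_witness[of _ "\<lambda>y. y / (y - 1)" "\<lambda>x. x / (x - 1)"])
    fix x :: 'a
    assume x: "x \<in> - {1}"
    show "x / (x - 1) / (x / (x - 1) - 1) = x" "x / (x - 1) \<in> - {1}"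
      using x by (auto simp: field_simps)
    define y where "y = x / (x - 1)"
    have xy: "x = - 1 * (y / (1 - y))" "1 - x = 1 / (1 - y)" "1 - y \<noteq> 0"
      using x by (auto simp: y_def divide_simps)
    have "A x = A (-1) * (A y / A (1 - y))" "\<chi> x = \<chi> (-1) * (\<chi> y / \<chi> (1 - y))"
      by (subst xy(1), simp only: mult_char_mult[OF A] mult_char_divide[OF A] mult_char_mult[OF \<chi>] mult_char_divide[OF \<chi>])+
    moreover have "\<chi> (1 - y) \<noteq> 0"
      using mult_char_eq_0_iff[OF \<chi>] xy(3) by blast
    ultimately show "(A * \<chi>) (-1) * (A (x / (x - 1)) * (inverse A * B) (1 - x / (x - 1)) * \<chi> (x / (x - 1))) =
        (A * \<chi>) x * inverse (B * \<chi>) (1 - x)"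
      unfolding y_def[symmetric] xy(2) times_fun_apply inverse_fun_apply mult_char_divide[OF B]
        mult_char_divide[OF \<chi>] mult_char_1[OF B] mult_char_1[OF \<chi>]
      by (simp add: field_simps)
  qed (auto simp: field_simps)
  also have "\<dots> = (\<Sum>y\<in>UNIV. (A * \<chi>) (-1) * (A y * (inverse A * B) (1 - y) * \<chi> y))"
    by (rule sum.mono_neutral_left) (use 0 in auto)
  also have "\<dots> = (A * \<chi>) (-1) * (\<Sum>y\<in>UNIV. A y * (inverse A * B) (1 - y) * \<chi> y)"
    by (simp only: sum_distrib_left)
  finally have eq: "(\<Sum>x\<in>UNIV. (A * \<chi>) x * inverse (B * \<chi>) (1 - x)) = \<dots>" .
  have "char_binom (A * \<chi>) (B * \<chi>) = \<chi> (-1) * \<chi> (-1) *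
      ((A * B) (-1) / of_nat CARD('a) * (\<Sum>y\<in>UNIV. A y * (inverse A * B) (1 - y) * \<chi> y))"
    unfolding char_binom_def eq by (simp only: times_fun_apply divide_inverse mult_ac)
  then show ?thesis
    by (simp only: mult_char_neg_1_squared[OF \<chi>] mult_1)
qed

text \<open>The analogue of the binomial series \<open>(1 - v) powr (- a)\<close>.\<close>

lemma sum_char_binom:
  fixes A :: "'a::{finite, field} \<Rightarrow> complex"
  assumes A: "mult_char A"
  shows "of_nat CARD('a) / (of_nat CARD('a) - 1) *
      (\<Sum>\<chi> | mult_char \<chi>. char_binom (A * \<chi>) \<chi> * \<chi> v) = (if v = 0 then 0 else inverse (A (1 - v)))"
proof -
  define q where "q = (of_nat CARD('a) :: complex)"
  have q: "q \<noteq> 0" "q - 1 \<noteq> 0"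
    using card_field_gt_1[where 'a = 'a] by (simp_all add: q_def)
  have "(\<Sum>\<chi> | mult_char \<chi>. char_binom (A * \<chi>) \<chi> * \<chi> v) =
      (\<Sum>\<chi> | mult_char \<chi>. \<Sum>x\<in>UNIV. A x / q * \<chi> (- 1 * (x * v / (1 - x))))"
  proof (rule sum.cong[OF refl])
    fix \<chi> :: "'a \<Rightarrow> complex"
    assume "\<chi> \<in> {\<chi>. mult_char \<chi>}"
    then have \<chi>: "mult_char \<chi>" by simp
    show "char_binom (A * \<chi>) \<chi> * \<chi> v = (\<Sum>x\<in>UNIV. A x / q * \<chi> (- 1 * (x * v / (1 - x))))"
      unfolding mult_char_mult[OF \<chi>] mult_char_divide[OF \<chi>]
      by (simp add: char_binom_def q_def sum_distrib_left sum_distrib_right divide_simps mult_ac)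
  qed
  also have "\<dots> = (\<Sum>x\<in>UNIV. A x / q * (if - 1 * (x * v / (1 - x)) = 1 then q - 1 else 0))"
    by (subst sum.swap) (simp only: sum_distrib_left[symmetric] sum_over_mult_chars q_def)
  \<comment> \<open>Orthogonality keeps only \<open>- x v = 1 - x\<close>, that is
    \<open>x = 1 / (1 - v)\<close>. For \<open>v = 1\<close> the default
    \<open>inverse 0 = 0\<close> is harmless because \<open>A 0 = 0\<close>; for
    \<open>v = 0\<close> no \<open>x\<close> solves the equation, hence the exceptional
    value.\<close>
  also have "\<dots> = (\<Sum>x\<in>UNIV. if x = inverse (1 - v) then (if v = 0 then 0 else A (inverse (1 - v)) / q * (q - 1)) else 0)"
  proof (rule sum.cong[OF refl])
    fix x
    show "A x / q * (if - 1 * (x * v / (1 - x)) = 1 then q - 1 else 0) =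
      (if x = inverse (1 - v) then (if v = 0 then 0 else A (inverse (1 - v)) / q * (q - 1)) else 0)"
    proof (cases "v = 1")
      case True
      then show ?thesis
        using mult_char_0[OF A] by (auto simp: divide_simps)
    next
      case False
      then have "- 1 * (x * v / (1 - x)) = 1 \<longleftrightarrow> x = inverse (1 - v) \<and> v \<noteq> 0"
        by (auto simp: divide_simps eq_neg_iff_add_eq_0) (auto simp: algebra_simps)
      then show ?thesis by auto
    qed
  qed
  also have "\<dots> = (if v = 0 then 0 else A (inverse (1 - v)) / q * (q - 1))"
    by simp
  finally show ?thesis
    using q by (simp add: mult_char_inverse[OF A] q_def)
qed

text \<open>Euler's integral: the second binomial becomes a Mellin transform in \<open>y\<close>,
  and what remains under it is the binomial series at \<open>v * y\<close>. The exceptional value of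
  that series at 0 occurs only for \<open>y = 0\<close>, where the weight \<open>B y\<close>
  vanishes.\<close>

lemma greene_F_2_1:
  fixes A B C :: "'a::{finite, field} \<Rightarrow> complex"
  assumes A: "mult_char A" and B: "mult_char B" and C: "mult_char C" and v: "v \<noteq> 0"
  shows "greene_F [A, B] [C] v = (B * C) (-1) / of_nat CARD('a) *
    (\<Sum>y\<in>UNIV. B y * (inverse B * C) (1 - y) * inverse (A (1 - v * y)))"
proof -
  define q where "q = (of_nat CARD('a) :: complex)"
  define w where "w y = B y * (inverse B * C) (1 - y)" for y
  have "greene_F [A, B] [C] v =
      q / (q - 1) * (\<Sum>\<chi> | mult_char \<chi>. char_binom (A * \<chi>) \<chi> * char_binom (B * \<chi>) (C * \<chi>) * \<chi> v)"
    by (simp add: greene_F_def q_def)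
  also have "(\<Sum>\<chi> | mult_char \<chi>. char_binom (A * \<chi>) \<chi> * char_binom (B * \<chi>) (C * \<chi>) * \<chi> v) =
      (\<Sum>\<chi> | mult_char \<chi>. \<Sum>y\<in>UNIV. (B * C) (-1) / q * w y * (char_binom (A * \<chi>) \<chi> * \<chi> (v * y)))"
  proof (rule sum.cong[OF refl])
    fix \<chi> :: "'a \<Rightarrow> complex"
    assume "\<chi> \<in> {\<chi>. mult_char \<chi>}"
    then have \<chi>: "mult_char \<chi>" by simp
    show "char_binom (A * \<chi>) \<chi> * char_binom (B * \<chi>) (C * \<chi>) * \<chi> v =
        (\<Sum>y\<in>UNIV. (B * C) (-1) / q * w y * (char_binom (A * \<chi>) \<chi> * \<chi> (v * y)))"
      unfolding char_binom_times[OF B C \<chi>] mult_char_mult[OF \<chi>] sum_distrib_left sum_distrib_right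
      by (simp only: w_def q_def mult_ac)
  qed
  also have "q / (q - 1) * \<dots> = (\<Sum>y\<in>UNIV. (B * C) (-1) / q * w y *
      (q / (q - 1) * (\<Sum>\<chi> | mult_char \<chi>. char_binom (A * \<chi>) \<chi> * \<chi> (v * y))))"
    by (subst sum.swap) (simp only: sum_distrib_left mult.left_commute)
  also have "\<dots> = (\<Sum>y\<in>UNIV. (B * C) (-1) / q * w y * inverse (A (1 - v * y)))"
    unfolding q_def sum_char_binom[OF A]
    by (rule sum.cong) (auto simp: v w_def mult_char_0[OF B])
  finally show ?thesis
    by (simp add: w_def q_def sum_distrib_left mult_ac)
qed

lemma greene_F_3_2:
  fixes A B C D E :: "'a::{finite, field} \<Rightarrow> complex"
  assumes A: "mult_char A" and B: "mult_char B" and C: "mult_char C"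
    and D: "mult_char D" and E: "mult_char E" and v: "v \<noteq> 0"
  shows "greene_F [A, B, C] [D, E] v = (B * D * C * E) (-1) / (of_nat CARD('a))\<^sup>2 *
    (\<Sum>y\<in>UNIV. \<Sum>z\<in>UNIV. C y * (inverse C * E) (1 - y) * (B z * (inverse B * D) (1 - z)) *
      inverse (A (1 - v * y * z)))"
proof -
  define q where "q = (of_nat CARD('a) :: complex)"
  define w where "w y = C y * (inverse C * E) (1 - y)" for y
  define w' where "w' z = B z * (inverse B * D) (1 - z)" for z
  define c where "c = (B * D * C * E) (-1) / q\<^sup>2"
  have "greene_F [A, B, C] [D, E] v = q / (q - 1) * (\<Sum>\<chi> | mult_char \<chi>. char_binom (A * \<chi>) \<chi> *
      (char_binom (B * \<chi>) (D * \<chi>) * char_binom (C * \<chi>) (E * \<chi>)) * \<chi> v)"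
    by (simp add: greene_F_def q_def numeral_2_eq_2 atLeastAtMostSuc_conv mult_ac)
  also have "(\<Sum>\<chi> | mult_char \<chi>. char_binom (A * \<chi>) \<chi> *
      (char_binom (B * \<chi>) (D * \<chi>) * char_binom (C * \<chi>) (E * \<chi>)) * \<chi> v) =
      (\<Sum>\<chi> | mult_char \<chi>. \<Sum>y\<in>UNIV. \<Sum>z\<in>UNIV.
        c * w y * w' z * (char_binom (A * \<chi>) \<chi> * \<chi> (v * y * z)))"
  proof (rule sum.cong[OF refl])
    fix \<chi> :: "'a \<Rightarrow> complex"
    assume "\<chi> \<in> {\<chi>. mult_char \<chi>}"
    then have \<chi>: "mult_char \<chi>" by simp
    have "char_binom (B * \<chi>) (D * \<chi>) * char_binom (C * \<chi>) (E * \<chi>) =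
        c * ((\<Sum>y\<in>UNIV. w y * \<chi> y) * (\<Sum>z\<in>UNIV. w' z * \<chi> z))"
      unfolding char_binom_times[OF B D \<chi>] char_binom_times[OF C E \<chi>]
      by (simp add: w_def w'_def c_def q_def power2_eq_square mult_ac)
    also have "\<dots> = (\<Sum>y\<in>UNIV. \<Sum>z\<in>UNIV. c * w y * w' z * (\<chi> y * \<chi> z))"
      by (simp add: sum_product sum_distrib_left mult_ac)
    finally show "char_binom (A * \<chi>) \<chi> *
        (char_binom (B * \<chi>) (D * \<chi>) * char_binom (C * \<chi>) (E * \<chi>)) * \<chi> v =
        (\<Sum>y\<in>UNIV. \<Sum>z\<in>UNIV. c * w y * w' z * (char_binom (A * \<chi>) \<chi> * \<chi> (v * y * z)))"
      by (simp only: mult_char_mult[OF \<chi>] sum_distrib_left sum_distrib_right mult_ac)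
  qed
  also have "q / (q - 1) * \<dots> = (\<Sum>y\<in>UNIV. \<Sum>z\<in>UNIV. c * w y * w' z *
      (q / (q - 1) * (\<Sum>\<chi> | mult_char \<chi>. char_binom (A * \<chi>) \<chi> * \<chi> (v * y * z))))"
  proof -
    have "(\<Sum>\<chi>\<in>M. \<Sum>y\<in>UNIV. \<Sum>z\<in>UNIV. F \<chi> y z) = (\<Sum>y\<in>UNIV. \<Sum>z\<in>UNIV. \<Sum>\<chi>\<in>M. F \<chi> y z)"
      for M and F :: "('a \<Rightarrow> complex) \<Rightarrow> 'a \<Rightarrow> 'a \<Rightarrow> complex"
      by (rule trans[OF sum.swap], rule sum.cong[OF refl], rule sum.swap)
    then show ?thesis
      by (simp add: sum_distrib_left mult.left_commute)
  qed
  also have "\<dots> = (\<Sum>y\<in>UNIV. \<Sum>z\<in>UNIV. c * w y * w' z * inverse (A (1 - v * y * z)))"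
    unfolding q_def sum_char_binom[OF A]
    by (intro sum.cong) (auto simp: v w_def w'_def mult_char_0[OF B] mult_char_0[OF C])
  finally show ?thesis
    by (simp add: w_def w'_def c_def q_def sum_distrib_left mult_ac)
qed

section \<open>The quadratic character\<close>

lemma odd_card_imp_2_neq_0:
  assumes "odd CARD('a::{finite, field})"
  shows "(2 :: 'a) \<noteq> 0"
proof
  assume "(2 :: 'a) = 0"
  then have "of_nat 2 = (0 :: 'a)" by simp
  then have "CHAR('a) dvd 2"
    by (simp only: of_nat_eq_0_iff_char_dvd)
  then have "CHAR('a) = 2"
    by (metis CHAR_not_1' One_nat_def prime_nat_iff two_is_prime_nat)
  then show False
    using CHAR_dvd_CARD[where 'a = 'a] assms by simp
qed

lemma quad_char_0 [simp]: "quad_char 0 = 0"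
  by (simp add: quad_char_def)

text \<open>On a power \<open>g ^ i\<close> of a generator the value is \<open>(-1) ^ i\<close>; the
  parity of \<open>i\<close> is well defined because \<open>CARD('a) - 1\<close> is even.\<close>

lemma mult_char_quad [simp]:
  assumes "odd CARD('a::{finite, field})"
  shows "mult_char (quad_char :: 'a \<Rightarrow> complex)"
proof -
  obtain g :: 'a where g: "g \<noteq> 0" "\<And>x. x \<noteq> 0 \<Longrightarrow> \<exists>i. x = g ^ i"
    using finite_field_generator by blast
  have quad: "quad_char (g ^ i) = (-1) ^ i" for i
  proof -
    have "even i" if "g ^ i = y\<^sup>2" for y
    proof -
      have "y \<noteq> 0"
        using that g(1) by auto
      then obtain j where "y = g ^ j"
        using g(2) by auto
      then have "g ^ i = g ^ (j * 2)"
        using that by (simp add: power_mult)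
      then have "i mod (CARD('a) - 1) = (j * 2) mod (CARD('a) - 1)"
        using generator_power_eq_iff[OF g] by simp
      moreover have "even (CARD('a) - 1)"
        using assms by simp
      ultimately show ?thesis
        by (metis dvd_mod_iff dvd_triv_right)
    qed
    moreover have "\<exists>y. g ^ i = y\<^sup>2" if "even i"
      using that by (metis evenE mult.commute power_mult)
    ultimately show ?thesis
      using g(1) by (cases "even i") (auto simp: quad_char_def)
  qed
  have "quad_char (x * y) = quad_char x * quad_char y" for x y :: 'a
  proof (cases "x = 0 \<or> y = 0")
    case False
    then obtain i j where "x = g ^ i" "y = g ^ j"
      using g(2) by metis
    then show ?thesis
      by (simp add: quad flip: power_add)
  qed (auto simp: quad_char_def)
  then show ?thesis
    using quad[of 0] by (simp add: mult_char_def)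
qed

lemma quad_char_square: "x \<noteq> 0 \<Longrightarrow> quad_char (x\<^sup>2) = 1"
  by (auto simp: quad_char_def)

lemma quad_char_cases: "x = 0 \<and> quad_char x = 0 \<or> x \<noteq> 0 \<and> (quad_char x = 1 \<or> quad_char x = -1)"
  by (simp add: quad_char_def)

lemma inverse_quad_char [simp]: "inverse (quad_char x) = quad_char x"
  by (simp add: quad_char_def)

lemma quad_char_mult_self [simp]: "x \<noteq> 0 \<Longrightarrow> quad_char x * quad_char x = 1"
  by (simp add: quad_char_def)

lemma quad_char_mult_square:
  assumes "odd CARD('a::{finite, field})" "y \<noteq> 0"
  shows "quad_char (x * y\<^sup>2) = quad_char (x :: 'a)"
  using assms by (simp add: mult_char_mult quad_char_square)

lemma of_nat_card_square_roots:
  assumes "odd CARD('a::{finite, field})"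
  shows "of_nat (card {s :: 'a. s\<^sup>2 = a}) = 1 + quad_char a"
proof -
  consider "a = 0" | b where "a = b\<^sup>2" "b \<noteq> 0" | "a \<noteq> 0" "\<not> (\<exists>b. a = b\<^sup>2)"
    by force
  then show ?thesis
  proof cases
    case (2 b)
    then have "b \<noteq> - b"
      using odd_card_imp_2_neq_0[OF assms]
      by (metis eq_neg_iff_add_eq_0 mult_2 mult_eq_0_iff)
    moreover have "{s. s\<^sup>2 = a} = {b, - b}"
      using 2 by (auto simp: power2_eq_iff)
    ultimately show ?thesis
      using 2 by (simp add: quad_char_square)
  next
    case 3
    then have "{s. s\<^sup>2 = a} = {}"
      by auto
    then show ?thesis
      using 3 by (simp add: quad_char_def)
  qed simp
qed

lemma sum_over_squares:
  assumes "odd CARD('a::{finite, field})"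
  shows "(\<Sum>s\<in>(UNIV :: 'a set). f (s\<^sup>2)) = (\<Sum>a\<in>UNIV. (1 + quad_char a) * f a)"
proof -
  have "(\<Sum>s\<in>(UNIV :: 'a set). f (s\<^sup>2)) = (\<Sum>a\<in>UNIV. \<Sum>s | s \<in> UNIV \<and> s\<^sup>2 = a. f (s\<^sup>2))"
    by (rule sum.group[symmetric]) auto
  also have "\<dots> = (\<Sum>a\<in>UNIV. (1 + quad_char a) * f a)"
    by (rule sum.cong[OF refl]) (simp add: of_nat_card_square_roots[OF assms, symmetric])
  finally show ?thesis .
qed

text \<open>Completing the square; the linear coefficient \<open>- 2 * \<beta>\<close> keeps the
  factor 4 out of the discriminant.\<close>

lemma of_nat_card_quadratic_roots:
  fixes \<alpha> \<beta> \<gamma> :: "'a::{finite, field}"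
  assumes "odd CARD('a)" and \<alpha>: "\<alpha> \<noteq> 0"
  shows "of_nat (card {s. \<alpha> * s\<^sup>2 - 2 * \<beta> * s + \<gamma> = 0}) = 1 + quad_char (\<beta>\<^sup>2 - \<alpha> * \<gamma>)"
proof -
  have "\<alpha> * s\<^sup>2 - 2 * \<beta> * s + \<gamma> = 0 \<longleftrightarrow> (\<alpha> * s - \<beta>)\<^sup>2 = \<beta>\<^sup>2 - \<alpha> * \<gamma>" for s
  proof -
    have "(\<alpha> * s - \<beta>)\<^sup>2 - (\<beta>\<^sup>2 - \<alpha> * \<gamma>) = \<alpha> * (\<alpha> * s\<^sup>2 - 2 * \<beta> * s + \<gamma>)"
      by (simp add: power2_eq_square algebra_simps)
    then show ?thesis
      using \<alpha> unfolding eq_iff_diff_eq_0[of "(\<alpha> * s - \<beta>)\<^sup>2"] by simp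
  qed
  then have eq: "{s. \<alpha> * s\<^sup>2 - 2 * \<beta> * s + \<gamma> = 0} = {s. (\<alpha> * s - \<beta>)\<^sup>2 = \<beta>\<^sup>2 - \<alpha> * \<gamma>}"
    by simp
  have bij: "bij_betw (\<lambda>s. \<alpha> * s - \<beta>) {s. (\<alpha> * s - \<beta>)\<^sup>2 = \<delta>} {t. t\<^sup>2 = \<delta>}" for \<delta>
    by (rule bij_betwI[of _ _ _ "\<lambda>t. (t + \<beta>) / \<alpha>"]) (use \<alpha> in auto)
  have "card {s. \<alpha> * s\<^sup>2 - 2 * \<beta> * s + \<gamma> = 0} = card {t. t\<^sup>2 = \<beta>\<^sup>2 - \<alpha> * \<gamma>}"
    unfolding eq by (rule bij_betw_same_card[OF bij])
  then show ?thesis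
    by (simp only: of_nat_card_square_roots[OF assms(1)])
qed

text \<open>Counting the elements by their squares: a trivial quadratic character would give
  \<open>q = q + (q - 1)\<close>.\<close>

lemma quad_char_nontriv:
  assumes "odd CARD('a::{finite, field})"
  shows "(quad_char :: 'a \<Rightarrow> complex) \<noteq> triv_char"
proof
  assume quad: "(quad_char :: 'a \<Rightarrow> complex) = triv_char"
  have "of_nat CARD('a) = (\<Sum>s\<in>(UNIV :: 'a set). (1 :: complex))"
    by simp
  also have "\<dots> = (\<Sum>a\<in>(UNIV :: 'a set). 1 + quad_char a)"
    using sum_over_squares[OF assms, of "\<lambda>_. 1"] by simp
  also have "\<dots> = of_nat CARD('a) + (of_nat CARD('a) - 1)"
    by (simp add: sum.distrib quad sum_triv_char)
  finally show False
    using card_field_gt_1[where 'a = 'a] by simp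
qed

lemma sum_quad_char:
  assumes "odd CARD('a::{finite, field})"
  shows "(\<Sum>x\<in>(UNIV :: 'a set). quad_char x) = 0"
  using sum_mult_char mult_char_quad[OF assms] quad_char_nontriv[OF assms] by blast

lemma sum_quad_char_translate:
  assumes "odd CARD('a::{finite, field})"
  shows "(\<Sum>x\<in>(UNIV :: 'a set). quad_char (x - u)) = 0"
  by (subst sum_quad_char[OF assms, symmetric],
      rule sum.reindex_bij_witness[of _ "\<lambda>x. x + u" "\<lambda>x. x - u"]) auto

text \<open>Evaluates the exceptional terms of the change of variables. With
  \<open>a = w\<^sup>2\<close> counted \<open>1 + quad_char a\<close> times, inverting
  \<open>a\<close> turns \<open>a (1 - u a)\<close> into \<open>1 / a - u\<close> up to a square. A
  complete sum of the quadratic character then lacks only the term at 0, which is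
  \<open>quad_char (- u)\<close>.\<close>

lemma sum_quad_char_1_minus_square:
  fixes u :: "'a::{finite, field}"
  assumes odd: "odd CARD('a)" and u: "u \<noteq> 0"
  shows "(\<Sum>w\<in>UNIV. quad_char (1 - u * w\<^sup>2)) = - quad_char (- u)"
proof -
  have "(\<Sum>w\<in>UNIV. quad_char (1 - u * w\<^sup>2)) = (\<Sum>a\<in>UNIV. (1 + quad_char a) * quad_char (1 - u * a))"
    by (rule sum_over_squares[OF odd])
  also have "\<dots> = (\<Sum>a\<in>UNIV. quad_char (1 - u * a)) + (\<Sum>a\<in>UNIV. quad_char a * quad_char (1 - u * a))"
    by (simp add: algebra_simps sum.distrib)
  also have "(\<Sum>a\<in>UNIV. quad_char (1 - u * a)) = (\<Sum>a\<in>(UNIV :: 'a set). quad_char a)"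
    by (rule sum.reindex_bij_witness[of _ "\<lambda>b. (1 - b) / u" "\<lambda>a. 1 - u * a"]) (use u in auto)
  also have "\<dots> = 0"
    by (rule sum_quad_char[OF odd])
  also have "(\<Sum>a\<in>UNIV. quad_char a * quad_char (1 - u * a)) =
      (\<Sum>a\<in>-{0}. quad_char a * quad_char (1 - u * a))"
    by (rule sum.mono_neutral_right) auto
  also have "\<dots> = (\<Sum>b\<in>-{0}. quad_char (b - u))"
  proof (rule sum.reindex_bij_witness[of _ inverse inverse])
    fix a :: 'a
    assume a: "a \<in> - {0}"
    have "a * (1 - u * a) = (inverse a - u) * a\<^sup>2"
      using a by (simp add: power2_eq_square algebra_simps)
    then have "quad_char a * quad_char (1 - u * a) = quad_char ((inverse a - u) * a\<^sup>2)"
      by (simp only: mult_char_mult[OF mult_char_quad[OF odd], symmetric])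
    also have "\<dots> = quad_char (inverse a - u)"
      using a by (intro quad_char_mult_square[OF odd]) auto
    finally show "quad_char (inverse a - u) = quad_char a * quad_char (1 - u * a)" ..
  qed auto
  also have "\<dots> = (\<Sum>b\<in>UNIV. quad_char (b - u)) - quad_char (- u)"
    by (subst sum.remove[of UNIV "0 :: 'a"]) (auto simp: Compl_eq_Diff_UNIV)
  finally show ?thesis
    by (simp add: sum_quad_char_translate[OF odd])
qed

section \<open>Gauss sums\<close>

text \<open>The Gauss sum arguments use the additive character only through these properties. The
  trace and the root of unity enter only when the locale is instantiated.\<close>

locale odd_field_add_char =
  fixes \<theta> :: "'a::{finite, field} \<Rightarrow> complex"
  assumes odd: "odd CARD('a)"
    and \<theta>_add: "\<theta> (x + y) = \<theta> x * \<theta> y"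
    and \<theta>_0 [simp]: "\<theta> 0 = 1"
    and \<theta>_nontriv: "\<exists>x. \<theta> x \<noteq> 1"
begin

definition q :: complex where "q = of_nat CARD('a)"

abbreviation \<phi> :: "'a \<Rightarrow> complex" where "\<phi> \<equiv> quad_char"

definition G :: "('a \<Rightarrow> complex) \<Rightarrow> complex" where "G \<chi> = (\<Sum>x\<in>UNIV. \<chi> x * \<theta> x)"

lemma q_neq_0 [simp]: "q \<noteq> 0"
  by (simp add: q_def)

lemma two_neq_0 [simp]: "(2 :: 'a) \<noteq> 0"
  by (rule odd_card_imp_2_neq_0[OF odd])

lemma four_neq_0 [simp]: "(4 :: 'a) \<noteq> 0"
proof -
  have "(4 :: 'a) = 2 * 2"
    by simp
  then show ?thesis
    by (metis mult_eq_0_iff two_neq_0)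
qed

lemma \<phi>_char [simp]: "mult_char \<phi>"
  by (rule mult_char_quad[OF odd])

lemma \<phi>_nontriv [simp]: "\<phi> \<noteq> triv_char"
  by (rule quad_char_nontriv[OF odd])

lemma \<phi>_mult: "\<phi> (x * y) = \<phi> x * \<phi> y"
  by (rule mult_char_mult) simp

lemma \<phi>_divide: "\<phi> (x / y) = \<phi> x * \<phi> y"
  by (simp add: divide_inverse \<phi>_mult mult_char_inverse)

lemma sum_\<theta>: "(\<Sum>x\<in>UNIV. \<theta> x) = 0"
proof -
  obtain a where a: "\<theta> a \<noteq> 1"
    using \<theta>_nontriv by blast
  have "(\<Sum>x\<in>UNIV. \<theta> x) = (\<Sum>x\<in>UNIV. \<theta> (a + x))"
    by (rule sum.reindex_bij_witness[of _ "\<lambda>x. a + x" "\<lambda>x. x - a"]) auto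
  also have "\<dots> = \<theta> a * (\<Sum>x\<in>UNIV. \<theta> x)"
    by (simp add: \<theta>_add sum_distrib_left)
  finally show ?thesis
    using a by simp
qed

lemma sum_\<theta>_mult: "(\<Sum>x\<in>UNIV. \<theta> (x * a)) = (if a = 0 then q else 0)"
proof (cases "a = 0")
  case False
  have "(\<Sum>x\<in>UNIV. \<theta> (x * a)) = (\<Sum>x\<in>UNIV. \<theta> x)"
    by (rule sum.reindex_bij_witness[of _ "\<lambda>x. x / a" "\<lambda>x. x * a"]) (use False in auto)
  then show ?thesis
    using False by (simp add: sum_\<theta>)
qed (simp add: q_def)

text \<open>Nontriviality makes the formula hold at \<open>w = 0\<close> too, where the left side
  vanishes by orthogonality and the right side by \<open>inverse 0 = 0\<close>. Hence
  \<open>1 / \<chi>\<close> can be expanded even at zeros of its argument.\<close>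

lemma gauss_twist:
  assumes \<chi>: "mult_char \<chi>" "\<chi> \<noteq> triv_char"
  shows "(\<Sum>x\<in>UNIV. \<chi> x * \<theta> (x * w)) = G \<chi> * inverse (\<chi> w)"
proof (cases "w = 0")
  case True
  then show ?thesis
    using sum_mult_char[OF \<chi>] by (simp add: mult_char_0[OF \<chi>(1)])
next
  case False
  have "(\<Sum>x\<in>UNIV. \<chi> x * \<theta> (x * w)) = (\<Sum>x\<in>UNIV. \<chi> (x / w) * \<theta> x)"
    by (rule sum.reindex_bij_witness[of _ "\<lambda>x. x / w" "\<lambda>x. x * w"]) (use False in auto)
  then show ?thesis
    unfolding G_def mult_char_divide[OF \<chi>(1)] sum_distrib_right by (simp only: divide_inverse mult_ac)
qed

lemma gauss_inverse:
  assumes \<chi>: "mult_char \<chi>" "\<chi> \<noteq> triv_char"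
  shows "G \<chi> * G (inverse \<chi>) = \<chi> (-1) * q"
proof -
  have "G \<chi> * G (inverse \<chi>) = (\<Sum>y\<in>UNIV. (G \<chi> * inverse (\<chi> y)) * \<theta> y)"
    by (simp add: G_def[of "inverse \<chi>"] sum_distrib_left mult_ac)
  also have "\<dots> = (\<Sum>y\<in>UNIV. \<Sum>x\<in>UNIV. \<chi> x * \<theta> (y * (x + 1)))"
    unfolding gauss_twist[OF \<chi>, symmetric] sum_distrib_right
    by (intro sum.cong refl) (simp add: \<theta>_add algebra_simps)
  also have "\<dots> = (\<Sum>x\<in>UNIV. \<chi> x * (\<Sum>y\<in>UNIV. \<theta> (y * (x + 1))))"
    by (subst sum.swap) (simp add: sum_distrib_left)
  also have "\<dots> = (\<Sum>x\<in>(UNIV :: 'a set). if x = -1 then \<chi> (-1) * q else 0)"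
    unfolding sum_\<theta>_mult by (intro sum.cong refl) (auto simp: add_eq_0_iff2)
  finally show ?thesis
    by simp
qed

lemma gauss_neq_0:
  assumes "mult_char \<chi>" "\<chi> \<noteq> triv_char"
  shows "G \<chi> \<noteq> 0"
  using gauss_inverse[OF assms] mult_char_neg_1_squared[OF assms(1)] q_neq_0
  by (metis mult_eq_0_iff zero_neq_one)

lemma inverse_\<phi> [simp]: "inverse \<phi> = \<phi>"
  by (rule ext) simp

lemma gauss_quad_squared: "G \<phi> * G \<phi> = \<phi> (-1) * q"
  using gauss_inverse[of \<phi>] by simp

section \<open>Quadratic exponential sums, Salie sums and the duplication formula\<close>

lemma sum_\<theta>_square:
  assumes "a \<noteq> 0"
  shows "(\<Sum>t\<in>UNIV. \<theta> (a * t\<^sup>2)) = \<phi> a * G \<phi>"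
proof -
  have "(\<Sum>t\<in>UNIV. \<theta> (a * t\<^sup>2)) = (\<Sum>x\<in>UNIV. (1 + \<phi> x) * \<theta> (x * a))"
    using sum_over_squares[OF odd, of "\<lambda>x. \<theta> (x * a)"] by (simp add: mult_ac)
  also have "\<dots> = (\<Sum>x\<in>UNIV. \<theta> (x * a)) + (\<Sum>x\<in>UNIV. \<phi> x * \<theta> (x * a))"
    by (simp add: algebra_simps sum.distrib)
  finally show ?thesis
    using assms by (simp add: sum_\<theta>_mult gauss_twist mult_ac)
qed

lemma sum_\<theta>_quadratic:
  assumes "k \<noteq> 0"
  shows "(\<Sum>t\<in>UNIV. \<theta> (2 * e * t - k * t\<^sup>2)) = \<theta> (e\<^sup>2 / k) * \<phi> (- k) * G \<phi>"
proof -
  have "(\<Sum>t\<in>UNIV. \<theta> (2 * e * t - k * t\<^sup>2)) = (\<Sum>t\<in>UNIV. \<theta> (e\<^sup>2 / k + - k * t\<^sup>2))"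
  proof (rule sum.reindex_bij_witness[of _ "\<lambda>t. t + e / k" "\<lambda>t. t - e / k"])
    fix t
    have "e\<^sup>2 / k + - k * (t - e / k)\<^sup>2 = 2 * e * t - k * t\<^sup>2"
      using assms by (simp add: power2_eq_square field_simps)
    then show "\<theta> (e\<^sup>2 / k + - k * (t - e / k)\<^sup>2) = \<theta> (2 * e * t - k * t\<^sup>2)"
      by simp
  qed auto
  also have "\<dots> = \<theta> (e\<^sup>2 / k) * (\<Sum>t\<in>UNIV. \<theta> (- k * t\<^sup>2))"
    by (simp only: \<theta>_add sum_distrib_left)
  also have "\<dots> = \<theta> (e\<^sup>2 / k) * \<phi> (- k) * G \<phi>"
    using assms by (subst sum_\<theta>_square) simp_all
  finally show ?thesis .
qed

text \<open>For \<open>b = d\<^sup>2\<close> the sum of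
  \<open>\<theta> (2 (k + d) t - k t\<^sup>2)\<close> over \<open>t\<close> and
  \<open>k \<noteq> 0\<close> is computed twice. Completing the square in \<open>t\<close> produces
  the left side, since \<open>(k + d)\<^sup>2 / k = 2 d + k + b / k\<close>. The exponent is also
  linear in \<open>k\<close>, so summing over \<open>k\<close> first singles out
  \<open>2 t = t\<^sup>2\<close>, that is \<open>t = 0\<close> and \<open>t = 2\<close>. If
  \<open>b\<close> is not a square, \<open>k \<mapsto> b / k\<close> changes the sign of the
  sum.\<close>

lemma sum_salie:
  "(\<Sum>k\<in>UNIV. \<phi> k * \<theta> (k + b / k)) = G \<phi> * (\<Sum>s | s\<^sup>2 = b. \<theta> (2 * s))"
proof -
  let ?S = "\<Sum>k\<in>UNIV. \<phi> k * \<theta> (k + b / k)"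
  consider "b = 0" | d where "b = d\<^sup>2" "d \<noteq> 0" | "b \<noteq> 0" "\<not> (\<exists>d. b = d\<^sup>2)"
    by (metis zero_power2)
  then show ?thesis
  proof cases
    case 1
    then show ?thesis by (simp add: G_def)
  next
    case (2 d)
    have "(\<Sum>k\<in>-{0}. \<Sum>t\<in>UNIV. \<theta> (2 * (k + d) * t - k * t\<^sup>2)) =
        (\<Sum>k\<in>-{0}. \<phi> (-1) * G \<phi> * \<theta> (2 * d) * (\<phi> k * \<theta> (k + b / k)))"
    proof (rule sum.cong[OF refl])
      fix k :: 'a
      assume k: "k \<in> - {0}"
      then have "(k + d)\<^sup>2 / k = 2 * d + (k + b / k)"
        using 2 by (simp add: power2_eq_square field_simps)
      then show "(\<Sum>t\<in>UNIV. \<theta> (2 * (k + d) * t - k * t\<^sup>2)) = \<phi> (-1) * G \<phi> * \<theta> (2 * d) * (\<phi> k * \<theta> (k + b / k))"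
        using k sum_\<theta>_quadratic[of k "k + d"] mult_char_minus[OF \<phi>_char, of k]
        by (simp add: \<theta>_add mult_ac)
    qed
    also have "\<dots> = \<phi> (-1) * G \<phi> * \<theta> (2 * d) * (\<Sum>k\<in>-{0}. \<phi> k * \<theta> (k + b / k))"
      by (simp only: sum_distrib_left)
    also have "(\<Sum>k\<in>-{0}. \<phi> k * \<theta> (k + b / k)) = ?S"
      by (rule sum.mono_neutral_left) auto
    finally have S: "\<phi> (-1) * G \<phi> * \<theta> (2 * d) * ?S = (\<Sum>k\<in>-{0}. \<Sum>t\<in>UNIV. \<theta> (2 * (k + d) * t - k * t\<^sup>2))" ..
    also have "\<dots> = (\<Sum>k\<in>-{0}. \<Sum>t\<in>UNIV. \<theta> (t * (2 * d)) * \<theta> (k * (2 * t - t\<^sup>2)))"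
      by (simp add: algebra_simps flip: \<theta>_add)
    also have "\<dots> = (\<Sum>t\<in>UNIV. \<theta> (t * (2 * d)) * (\<Sum>k\<in>-{0}. \<theta> (k * (2 * t - t\<^sup>2))))"
      by (subst sum.swap) (simp only: sum_distrib_left)
    \<comment> \<open>The \<open>- 1\<close> accounts for the missing \<open>k = 0\<close>. It
      disappears in the sum over \<open>t\<close>, because \<open>2 * d \<noteq> 0\<close>.\<close>
    also have "\<dots> = (\<Sum>t\<in>UNIV. \<theta> (t * (2 * d)) * ((if t \<in> {0, 2} then q else 0) - 1))"
    proof (rule sum.cong[OF refl])
      fix t :: 'a
      have "(\<Sum>k\<in>-{0}. \<theta> (k * (2 * t - t\<^sup>2))) = (\<Sum>k\<in>UNIV. \<theta> (k * (2 * t - t\<^sup>2))) - 1"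
        by (subst sum.remove[of UNIV "0 :: 'a"]) (auto simp: Compl_eq_Diff_UNIV)
      moreover have "2 * t - t\<^sup>2 = 0 \<longleftrightarrow> t \<in> {0, 2}"
        by (auto simp: power2_eq_square)
      ultimately show "\<theta> (t * (2 * d)) * (\<Sum>k\<in>-{0}. \<theta> (k * (2 * t - t\<^sup>2))) =
          \<theta> (t * (2 * d)) * ((if t \<in> {0, 2} then q else 0) - 1)"
        by (simp only: sum_\<theta>_mult)
    qed
    also have "\<dots> = (\<Sum>t\<in>UNIV. if t \<in> {0, 2} then q * \<theta> (t * (2 * d)) else 0) - (\<Sum>t\<in>UNIV. \<theta> (t * (2 * d)))"
      by (subst sum_subtractf[symmetric]) (intro sum.cong refl, auto simp: algebra_simps)
    also have "\<dots> = (\<Sum>t\<in>{0, 2}. q * \<theta> (t * (2 * d)))"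
    proof -
      have "(\<Sum>t\<in>UNIV. if t \<in> T then f t else 0) = sum f T" for T :: "'a set" and f :: "'a \<Rightarrow> complex"
        by (simp add: sum.If_cases)
      then show ?thesis
        using 2 by (simp only: sum_\<theta>_mult) simp
    qed
    also have "\<dots> = q * (1 + \<theta> (2 * (2 * d)))"
      proof -
      have "0 \<notin> {2 :: 'a}"
        using two_neq_0 by (metis singletonD)
      then show ?thesis
        by (subst sum.insert[OF finite]) (simp_all add: algebra_simps)
    qed
    also have "\<dots> = \<phi> (-1) * G \<phi> * \<theta> (2 * d) * (G \<phi> * (\<theta> (2 * d) + \<theta> (2 * - d)))"
    proof -
      have "\<theta> (2 * d) * (\<theta> (2 * d) + \<theta> (2 * - d)) = 1 + \<theta> (2 * (2 * d))"
        unfolding distrib_left \<theta>_add[symmetric] by (simp add: algebra_simps)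
      moreover have "\<phi> (-1) * (G \<phi> * G \<phi>) = q"
        unfolding gauss_quad_squared by (simp flip: mult.assoc)
      moreover have "\<phi> (-1) * G \<phi> * \<theta> (2 * d) * (G \<phi> * (\<theta> (2 * d) + \<theta> (2 * - d))) =
          \<phi> (-1) * (G \<phi> * G \<phi>) * (\<theta> (2 * d) * (\<theta> (2 * d) + \<theta> (2 * - d)))"
        by (simp only: mult_ac)
      ultimately show ?thesis
        by (simp only:)
    qed
    finally have eq: "\<phi> (-1) * G \<phi> * \<theta> (2 * d) * ?S =
        \<phi> (-1) * G \<phi> * \<theta> (2 * d) * (G \<phi> * (\<theta> (2 * d) + \<theta> (2 * - d)))" .
    have neq: "\<phi> (-1) * G \<phi> * \<theta> (2 * d) \<noteq> 0"
    proof -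
      have "\<phi> (-1) \<noteq> 0"
        using quad_char_cases[of "-1 :: 'a"] by auto
      moreover have "\<theta> (2 * d) \<noteq> 0"
        using \<theta>_add[of "2 * d" "- (2 * d)"] by auto
      ultimately show ?thesis
        using gauss_neq_0[of \<phi>] by simp
    qed
    have "?S = G \<phi> * (\<theta> (2 * d) + \<theta> (2 * - d))"
      using eq unfolding mult_left_cancel[OF neq] .
    moreover have "{s. s\<^sup>2 = b} = {d, - d}"
      using 2 by (auto simp: power2_eq_iff)
    moreover have "d \<noteq> - d"
    proof
      assume "d = - d"
      then have "2 * d = 0"
        by (simp only: eq_neg_iff_add_eq_0 mult_2)
      with 2 two_neq_0 show False
        by simp
    qed
    ultimately show ?thesis
      by simp
  next
    case 3
    then have b: "\<phi> b = -1" "{s. s\<^sup>2 = b} = {}"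
      by (auto simp: quad_char_def)
    have "?S = (\<Sum>k\<in>-{0}. \<phi> k * \<theta> (k + b / k))"
      by (rule sum.mono_neutral_right) auto
    also have "\<dots> = (\<Sum>k\<in>-{0}. \<phi> (b / k) * \<theta> (k + b / k))"
      by (rule sum.reindex_bij_witness[of _ "\<lambda>k. b / k" "\<lambda>k. b / k"]) (use 3 in \<open>auto simp: add.commute\<close>)
    also have "\<dots> = (\<Sum>k\<in>UNIV. - (\<phi> k * \<theta> (k + b / k)))"
      by (rule sum.mono_neutral_cong_left) (auto simp: \<phi>_divide b)
    also have "\<dots> = - ?S"
      by (rule sum_negf)
    finally show ?thesis
      using b by simp
  qed
qed

text \<open>The Hasse-Davenport relation for the quadratic character. With \<open>b = n * k\<close>
  as a variable, the product of the Gauss sums is a sum of \<open>A b\<close> times a Salie sum,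
  which evaluates to a sum of \<open>A (s\<^sup>2) * \<theta> (2 * s)\<close> over all
  \<open>s\<close>. Removing the 2 by a twist costs \<open>(A\<^sup>2) 2 = A 4\<close>.\<close>

lemma gauss_duplication:
  assumes A: "mult_char A" and A2: "A\<^sup>2 \<noteq> triv_char"
  shows "G A * G (A * \<phi>) = inverse (A 4) * G (A\<^sup>2) * G \<phi>"
proof -
  have "G A * G (A * \<phi>) = (\<Sum>k\<in>UNIV. \<Sum>n\<in>UNIV. A (n * k) * \<phi> k * \<theta> (n + k))"
    unfolding G_def sum_product
    by (subst sum.swap) (simp add: mult_char_mult[OF A] \<theta>_add mult_ac)
  also have "\<dots> = (\<Sum>k\<in>UNIV. \<Sum>b\<in>UNIV. A b * (\<phi> k * \<theta> (k + b / k)))"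
  proof (rule sum.cong[OF refl])
    fix k :: 'a
    show "(\<Sum>n\<in>UNIV. A (n * k) * \<phi> k * \<theta> (n + k)) = (\<Sum>b\<in>UNIV. A b * (\<phi> k * \<theta> (k + b / k)))"
      by (cases "k = 0", simp,
          rule sum.reindex_bij_witness[of _ "\<lambda>b. b / k" "\<lambda>n. n * k"]) (auto simp: add.commute)
  qed
  also have "\<dots> = (\<Sum>b\<in>UNIV. A b * (G \<phi> * (\<Sum>s | s\<^sup>2 = b. \<theta> (2 * s))))"
    by (subst sum.swap) (simp only: sum_distrib_left[symmetric] sum_salie)
  also have "\<dots> = G \<phi> * (\<Sum>b\<in>UNIV. \<Sum>s | s \<in> UNIV \<and> s\<^sup>2 = b. A (s\<^sup>2) * \<theta> (2 * s))"
    by (simp add: sum_distrib_left mult_ac)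
  also have "\<dots> = G \<phi> * (\<Sum>s\<in>UNIV. (A\<^sup>2) s * \<theta> (s * 2))"
    by (subst sum.group) (simp_all add: mult_char_power[OF A] mult_ac)
  also have "\<dots> = G \<phi> * (G (A\<^sup>2) * inverse ((A\<^sup>2) 2))"
    by (simp only: gauss_twist[OF mult_char_power2[OF A] A2])
  also have "(A\<^sup>2) 2 = A 4"
    using mult_char_power[OF A, of 2 2] by simp
  finally show ?thesis
    by (simp only: mult_ac)
qed

end

section \<open>The square of the hypergeometric function as a product\<close>

context odd_field_add_char
begin

text \<open>
  Up to constants, \<open>gegenbauer_sum A B c\<close> is the Gegenbauer function with generating function
  \<open>(1 - 2 c r + r\<^sup>2) powr (- a - b)\<close>.
\<close>

definition gegenbauer_sum :: "('a \<Rightarrow> complex) \<Rightarrow> ('a \<Rightarrow> complex) \<Rightarrow> 'a \<Rightarrow> complex" where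
  "gegenbauer_sum A B c = (\<Sum>r\<in>UNIV. (A r)\<^sup>2 * inverse ((A * B) (1 - 2 * c * r + r\<^sup>2)))"

text \<open>A common refinement of the other two sums: summing out \<open>k\<close> is a Salie
  evaluation and leads to \<open>gegenbauer_sum\<close>, summing out \<open>n\<close> and
  \<open>k\<close> gives two Gauss sums and leads to \<open>euler_sum\<close>. The division by
  \<open>k = 0\<close> is harmless because \<open>\<phi> 0 = 0\<close>.\<close>

definition kloosterman_sum :: "('a \<Rightarrow> complex) \<Rightarrow> ('a \<Rightarrow> complex) \<Rightarrow> 'a \<Rightarrow> complex" where
  "kloosterman_sum A B c =
    (\<Sum>m\<in>UNIV. \<Sum>n\<in>UNIV. \<Sum>k\<in>UNIV. A n * B m * \<phi> k * \<theta> (m + n + k + c\<^sup>2 * (m * n) / k))"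

text \<open>The integral in \<open>greene_F_2_1\<close> at \<open>1 - c\<^sup>2\<close>, in the
  variable \<open>z = y / (1 - y)\<close>. The finite singular points are then 0, -1 and
  \<open>- 1 / c\<^sup>2\<close>.\<close>

definition euler_sum :: "('a \<Rightarrow> complex) \<Rightarrow> ('a \<Rightarrow> complex) \<Rightarrow> 'a \<Rightarrow> complex" where
  "euler_sum A B c = (\<Sum>z\<in>UNIV. B z * inverse ((B * \<phi>) (1 + z)) * inverse (A (1 + c\<^sup>2 * z)))"

text \<open>Needed because the reflection of the Euler sum interchanges the two characters.\<close>

lemma kloosterman_sum_commute: "kloosterman_sum A B c = kloosterman_sum B A c"
  unfolding kloosterman_sum_def by (subst sum.swap) (simp only: ac_simps)

text \<open>The scaling \<open>s \<mapsto> - c s\<close> matches the two sets of square roots only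
  for \<open>c \<noteq> 0\<close>; this is one of the places where \<open>x \<noteq> 1 / 2\<close>
  enters.\<close>

lemma sum_salie_scaled:
  assumes "c \<noteq> 0"
  shows "G \<phi> * (\<Sum>s | s\<^sup>2 = b. \<theta> (- (2 * c * s))) = (\<Sum>k\<in>UNIV. \<phi> k * \<theta> (k + c\<^sup>2 * b / k))"
proof -
  have "(\<Sum>s | s\<^sup>2 = b. \<theta> (- (2 * c * s))) = (\<Sum>s | s\<^sup>2 = c\<^sup>2 * b. \<theta> (2 * s))"
    by (rule sum.reindex_bij_witness[of _ "\<lambda>s. - s / c" "\<lambda>s. - (c * s)"])
       (use assms in \<open>auto simp: power_mult_distrib power_divide mult.assoc\<close>)
  then show ?thesis
    by (simp only: sum_salie)
qed

lemma gegenbauer_sum_eq_kloosterman_sum: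
  assumes A: "mult_char A" and B: "mult_char B" and AB: "A * B \<noteq> triv_char" and c: "c \<noteq> 0"
  shows "gegenbauer_sum A B c * G (A * B) * G \<phi> = kloosterman_sum A B c"
proof -
  have "gegenbauer_sum A B c * G (A * B) =
      (\<Sum>r\<in>UNIV. (A r)\<^sup>2 * (G (A * B) * inverse ((A * B) (1 - 2 * c * r + r\<^sup>2))))"
    unfolding gegenbauer_sum_def sum_distrib_right by (simp only: mult_ac)
  also have "\<dots> = (\<Sum>m\<in>UNIV. \<Sum>r\<in>UNIV. (A r)\<^sup>2 * ((A * B) m * \<theta> (m * (1 - 2 * c * r + r\<^sup>2))))"
    unfolding gauss_twist[OF mult_char_times[OF A B] AB, symmetric]
    by (subst sum.swap) (simp only: sum_distrib_left)
  also have "\<dots> = (\<Sum>m\<in>UNIV. \<Sum>n\<in>UNIV. A n * B m * \<theta> (m + n) * (\<Sum>s | s\<^sup>2 = m * n. \<theta> (- (2 * c * s))))"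
  proof (rule sum.cong[OF refl])
    fix m
    show "(\<Sum>r\<in>UNIV. (A r)\<^sup>2 * ((A * B) m * \<theta> (m * (1 - 2 * c * r + r\<^sup>2)))) =
        (\<Sum>n\<in>UNIV. A n * B m * \<theta> (m + n) * (\<Sum>s | s\<^sup>2 = m * n. \<theta> (- (2 * c * s))))"
    proof (cases "m = 0")
      case True
      then show ?thesis
        by (simp add: mult_char_0[OF A] mult_char_0[OF B])
    next
      case False
      then have "A m \<noteq> 0"
        using mult_char_eq_0_iff[OF A] by blast
      \<comment> \<open>With \<open>s = m r\<close> and
        \<open>n = s\<^sup>2 / m = m r\<^sup>2\<close> the exponent is \<open>m + n - 2 c s\<close>,
        and the factors \<open>A r\<close>, \<open>A r\<close>, \<open>A m\<close> combine to
        \<open>A n\<close>. For given \<open>m\<close> and \<open>n\<close> the variable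
        \<open>s\<close> runs over the square roots of \<open>m n\<close>, as in a Salie
        evaluation.\<close>
      have "(\<Sum>r\<in>UNIV. (A r)\<^sup>2 * ((A * B) m * \<theta> (m * (1 - 2 * c * r + r\<^sup>2)))) =
          (\<Sum>s\<in>UNIV. A (s\<^sup>2 / m) * B m * \<theta> (m + s\<^sup>2 / m) * \<theta> (- (2 * c * s)))"
      proof (rule sum.reindex_bij_witness[of _ "\<lambda>s. s / m" "\<lambda>r. m * r"])
        fix r
        have "(m * r)\<^sup>2 / m = m * r\<^sup>2"
          using False by (simp add: power2_eq_square)
        moreover have "m * (1 - 2 * c * r + r\<^sup>2) = m + m * r\<^sup>2 + - (2 * c * (m * r))"
          by (simp add: algebra_simps)
        ultimately show "A ((m * r)\<^sup>2 / m) * B m * \<theta> (m + (m * r)\<^sup>2 / m) * \<theta> (- (2 * c * (m * r))) =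
            (A r)\<^sup>2 * ((A * B) m * \<theta> (m * (1 - 2 * c * r + r\<^sup>2)))"
          by (simp only: \<theta>_add mult_char_mult[OF A] mult_char_power[OF A] times_fun_apply mult_ac)
      qed (use False in auto)
      also have "\<dots> = (\<Sum>n\<in>UNIV. \<Sum>s | s \<in> UNIV \<and> s\<^sup>2 / m = n.
          A (s\<^sup>2 / m) * B m * \<theta> (m + s\<^sup>2 / m) * \<theta> (- (2 * c * s)))"
        by (rule sum.group[symmetric]) auto
      also have "\<dots> = (\<Sum>n\<in>UNIV. A n * B m * \<theta> (m + n) * (\<Sum>s | s\<^sup>2 = m * n. \<theta> (- (2 * c * s))))"
        unfolding sum_distrib_left using False by (intro sum.cong) (auto simp: field_simps)
      finally show ?thesis .
    qed
  qed
  finally have "gegenbauer_sum A B c * G (A * B) * G \<phi> =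
      (\<Sum>m\<in>UNIV. \<Sum>n\<in>UNIV. A n * B m * \<theta> (m + n) * (\<Sum>s | s\<^sup>2 = m * n. \<theta> (- (2 * c * s)))) * G \<phi>"
    by (rule arg_cong)
  also have "\<dots> = (\<Sum>m\<in>UNIV. \<Sum>n\<in>UNIV. A n * B m * \<theta> (m + n) *
      (G \<phi> * (\<Sum>s | s\<^sup>2 = m * n. \<theta> (- (2 * c * s)))))"
    unfolding sum_distrib_right[of _ _ "G \<phi>"] by (simp only: mult_ac)
  also have "\<dots> = kloosterman_sum A B c"
    unfolding kloosterman_sum_def sum_salie_scaled[OF c] unfolding sum_distrib_left
    by (simp only: \<theta>_add mult_ac)
  finally show ?thesis .
qed

text \<open>The exponent is linear in \<open>n\<close> with coefficient
  \<open>1 + c\<^sup>2 m / k\<close>, which yields the Gauss sum of \<open>A\<close>. After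
  \<open>m = z k\<close> it is linear in \<open>k\<close> with coefficient \<open>1 + z\<close>,
  which yields that of \<open>B * \<phi>\<close>.\<close>

lemma kloosterman_sum_eq_euler_sum:
  assumes A: "mult_char A" and B: "mult_char B"
    and A': "A \<noteq> triv_char" and B': "B * \<phi> \<noteq> triv_char"
  shows "kloosterman_sum A B c = G A * G (B * \<phi>) * euler_sum A B c"
proof -
  have "kloosterman_sum A B c = (\<Sum>k\<in>UNIV. \<Sum>m\<in>UNIV. \<Sum>n\<in>UNIV.
      A n * B m * \<phi> k * \<theta> (m + n + k + c\<^sup>2 * (m * n) / k))"
  proof -
    have "(\<Sum>m\<in>UNIV. \<Sum>n\<in>UNIV. \<Sum>k\<in>UNIV. f k m n) = (\<Sum>k\<in>UNIV. \<Sum>m\<in>UNIV. \<Sum>n\<in>UNIV. f k m n)"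
      for f :: "'a \<Rightarrow> 'a \<Rightarrow> 'a \<Rightarrow> complex"
    proof -
      have "(\<Sum>m\<in>UNIV. \<Sum>n\<in>UNIV. \<Sum>k\<in>UNIV. f k m n) = (\<Sum>m\<in>UNIV. \<Sum>k\<in>UNIV. \<Sum>n\<in>UNIV. f k m n)"
        by (rule sum.cong[OF refl], rule sum.swap)
      also have "\<dots> = (\<Sum>k\<in>UNIV. \<Sum>m\<in>UNIV. \<Sum>n\<in>UNIV. f k m n)"
        by (rule sum.swap)
      finally show ?thesis .
    qed
    then show ?thesis
      unfolding kloosterman_sum_def .
  qed
  also have "\<dots> = (\<Sum>k\<in>UNIV. \<Sum>z\<in>UNIV.
      G A * B z * inverse (A (1 + c\<^sup>2 * z)) * ((B * \<phi>) k * \<theta> (k * (1 + z))))"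
  proof (rule sum.cong[OF refl])
    fix k
    show "(\<Sum>m\<in>UNIV. \<Sum>n\<in>UNIV. A n * B m * \<phi> k * \<theta> (m + n + k + c\<^sup>2 * (m * n) / k)) =
        (\<Sum>z\<in>UNIV. G A * B z * inverse (A (1 + c\<^sup>2 * z)) * ((B * \<phi>) k * \<theta> (k * (1 + z))))"
    proof (cases "k = 0")
      case True
      then show ?thesis by simp
    next
      case False
      have "(\<Sum>m\<in>UNIV. \<Sum>n\<in>UNIV. A n * B m * \<phi> k * \<theta> (m + n + k + c\<^sup>2 * (m * n) / k)) =
          (\<Sum>m\<in>UNIV. B m * \<phi> k * \<theta> (m + k) * (\<Sum>n\<in>UNIV. A n * \<theta> (n * (1 + c\<^sup>2 * (m / k)))))"
        unfolding sum_distrib_left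
      proof (intro sum.cong refl)
        fix m n
        have "m + n + k + c\<^sup>2 * (m * n) / k = (m + k) + n * (1 + c\<^sup>2 * (m / k))"
          by (simp add: algebra_simps)
        then show "A n * B m * \<phi> k * \<theta> (m + n + k + c\<^sup>2 * (m * n) / k) =
            B m * \<phi> k * \<theta> (m + k) * (A n * \<theta> (n * (1 + c\<^sup>2 * (m / k))))"
          by (simp only: \<theta>_add mult_ac)
      qed
      also have "\<dots> = (\<Sum>m\<in>UNIV. B m * \<phi> k * \<theta> (m + k) * (G A * inverse (A (1 + c\<^sup>2 * (m / k)))))"
        by (simp only: gauss_twist[OF A A'])
      also have "\<dots> = (\<Sum>z\<in>UNIV. G A * B z * inverse (A (1 + c\<^sup>2 * z)) * ((B * \<phi>) k * \<theta> (k * (1 + z))))"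
      proof (rule sum.reindex_bij_witness[of _ "\<lambda>z. z * k" "\<lambda>m. m / k"])
        fix m
        have "B m = B (m / k) * B k" and "k * (1 + m / k) = m + k"
          using False by (simp_all add: algebra_simps flip: mult_char_mult[OF B])
        then show "G A * B (m / k) * inverse (A (1 + c\<^sup>2 * (m / k))) * ((B * \<phi>) k * \<theta> (k * (1 + m / k))) =
            B m * \<phi> k * \<theta> (m + k) * (G A * inverse (A (1 + c\<^sup>2 * (m / k))))"
          by (simp only: times_fun_apply mult_ac)
      qed (use False in auto)
      finally show ?thesis .
    qed
  qed
  also have "\<dots> = (\<Sum>z\<in>UNIV. G A * B z * inverse (A (1 + c\<^sup>2 * z)) *
      (\<Sum>k\<in>UNIV. (B * \<phi>) k * \<theta> (k * (1 + z))))"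
    by (subst sum.swap) (simp only: sum_distrib_left)
  also have "\<dots> = G A * G (B * \<phi>) * euler_sum A B c"
    unfolding gauss_twist[OF mult_char_times[OF B \<phi>_char] B'] euler_sum_def sum_distrib_left
    by (simp only: mult_ac)
  finally show ?thesis .
qed

lemma greene_F_eq_euler_sum:
  assumes A: "mult_char A" and B: "mult_char B" and u: "1 - c\<^sup>2 \<noteq> 0"
  shows "greene_F [A, B] [A * B * \<phi>] (1 - c\<^sup>2) = (A * \<phi>) (-1) / q * euler_sum A B c"
proof -
  note 0 = mult_char_0[OF A] mult_char_0[OF B]
  let ?f = "\<lambda>y. B y * (inverse B * (A * B * \<phi>)) (1 - y) * inverse (A (1 - (1 - c\<^sup>2) * y))"
  let ?g = "\<lambda>z. B z * inverse ((B * \<phi>) (1 + z)) * inverse (A (1 + c\<^sup>2 * z))"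
  have "(\<Sum>y\<in>UNIV. ?f y) = (\<Sum>y\<in>-{1}. ?f y)"
    by (rule sum.mono_neutral_right) (use 0 in auto)
  also have "\<dots> = (\<Sum>z\<in>-{-1}. ?g z)"
  proof (rule sum.reindex_bij_witness[of _ "\<lambda>z. z / (1 + z)" "\<lambda>y. y / (1 - y)"])
    fix z :: 'a
    assume z: "z \<in> - {- 1}"
    then have z': "1 + z \<noteq> 0"
      by (simp add: add_eq_0_iff)
    then show "z / (1 + z) / (1 - z / (1 + z)) = z" "z / (1 + z) \<in> - {1}"
      by (auto simp: divide_simps)
  next
    fix y :: 'a
    assume y: "y \<in> - {1}"
    define z where "z = y / (1 - y)"
    have z: "1 + z \<noteq> 0" "y = z / (1 + z)" "1 - y = 1 / (1 + z)" "1 - (1 - c\<^sup>2) * y = (1 + c\<^sup>2 * z) / (1 + z)"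
      using y by (auto simp: z_def divide_simps) (auto simp: algebra_simps)
    then show "y / (1 - y) / (1 + y / (1 - y)) = y" "y / (1 - y) \<in> - {- 1}"
      by (simp_all add: z_def[symmetric] add_eq_0_iff)
    have nz: "A (1 + z) \<noteq> 0" "B (1 + z) \<noteq> 0"
      using z(1) mult_char_eq_0_iff[OF A] mult_char_eq_0_iff[OF B] by blast+
    have "B y = B z / B (1 + z)"
      by (subst z(2)) (simp only: mult_char_divide[OF B])
    then show "?g (y / (1 - y)) = ?f y"
      unfolding z_def[symmetric]
      unfolding z(3,4) times_fun_apply inverse_fun_apply mult_char_divide[OF A]
        mult_char_divide[OF B] \<phi>_divide mult_char_1[OF A] mult_char_1[OF B] mult_char_1[OF \<phi>_char]
        inverse_mult_distrib inverse_quad_char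
      using nz by (simp add: divide_simps)
  qed
  also have "\<dots> = (\<Sum>z\<in>UNIV. ?g z)"
    by (rule sum.mono_neutral_left) (use 0 in auto)
  finally have "(\<Sum>y\<in>UNIV. ?f y) = euler_sum A B c"
    by (simp only: euler_sum_def)
  moreover have "(B * (A * B * \<phi>)) (-1) = (A * \<phi>) (-1)"
    using mult_char_neg_1_squared[OF B] by simp
  ultimately show ?thesis
    using greene_F_2_1[OF A B _ u, of "A * B * \<phi>"] A B by (simp only: mult_char_times \<phi>_char q_def)
qed

text \<open>For \<open>C = A * B * \<phi>\<close> the factor
  \<open>\<phi> (1 - c\<^sup>2) / (A * B) (1 - c\<^sup>2)\<close> is the analogue of
  \<open>u powr (1 - C)\<close>, the leading term of the second local solution of the hypergeometric
  equation at \<open>u = 0\<close>. Here both solutions are proportional.\<close>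

lemma euler_sum_reflect:
  assumes A: "mult_char A" and B: "mult_char B" and c: "c \<noteq> 0" and u': "1 - c\<^sup>2 \<noteq> 0"
  shows "euler_sum A B c =
    \<phi> (- (1 - c\<^sup>2)) * inverse ((A * B) (1 - c\<^sup>2)) * euler_sum (inverse B) (inverse A) c"
proof -
  note 0 = mult_char_0[OF A] mult_char_0[OF B]
  define u where "u = 1 - c\<^sup>2"
  then have u: "u \<noteq> 0"
    using u' by simp
  let ?f = "\<lambda>z. B z * inverse ((B * \<phi>) (1 + z)) * inverse (A (1 + c\<^sup>2 * z))"
  let ?g = "\<lambda>z. (inverse A) z * inverse ((inverse A * \<phi>) (1 + z)) * inverse ((inverse B) (1 + c\<^sup>2 * z))"
  \<comment> \<open>The Moebius involution exchanging 0 with \<open>- 1 / c\<^sup>2\<close> and -1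
    with infinity. It permutes the singular points of the integrand, so \<open>A\<close> and
    \<open>B\<close> trade places and are inverted.\<close>
  let ?h = "\<lambda>z. - ((1 + c\<^sup>2 * z) / (c\<^sup>2 * (1 + z)))"
  have h: "1 + ?h z = - (u / (c\<^sup>2 * (1 + z)))" "1 + c\<^sup>2 * ?h z = z * u / (1 + z)" if "z \<noteq> - 1" for z
  proof -
    have "1 + z \<noteq> 0"
      using that by (simp add: add_eq_0_iff)
    then show "1 + ?h z = - (u / (c\<^sup>2 * (1 + z)))" "1 + c\<^sup>2 * ?h z = z * u / (1 + z)"
      using c by (auto simp: u_def divide_simps) (auto simp: algebra_simps)
  qed
  have h_h: "?h (?h z) = z" and h_neq: "?h z \<noteq> - 1" if "z \<noteq> - 1" for z
  proof -
    have "1 + z \<noteq> 0"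
      using that by (simp add: add_eq_0_iff)
    then show "?h z \<noteq> - 1"
      using h(1)[OF that] u c by (auto simp: add_eq_0_iff)
    show "?h (?h z) = z"
      unfolding h[OF that] using c u \<open>1 + z \<noteq> 0\<close> by (simp add: divide_simps)
  qed
  have "euler_sum A B c = (\<Sum>z\<in>-{-1}. ?f z)"
    unfolding euler_sum_def by (rule sum.mono_neutral_right) (use 0 in auto)
  also have "\<dots> = (\<Sum>z\<in>-{-1}. \<phi> (- u) * inverse ((A * B) u) * ?g z)"
  proof (rule sum.reindex_bij_witness[of _ ?h ?h])
    fix z :: 'a
    assume "z \<in> - {- 1}"
    then have z: "z \<noteq> - 1" and z': "1 + z \<noteq> 0"
      by (auto simp: add_eq_0_iff)
    show "?h (?h z) = z" "?h (?h z) = z" "?h z \<in> - {- 1}" "?h z \<in> - {- 1}"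
      using h_h[OF z] h_neq[OF z] by simp_all
    define w where "w = ?h z"
    then have z_eq: "z = ?h w" and w: "w \<noteq> - 1" and w': "1 + w \<noteq> 0"
      using h_h[OF z] h_neq[OF z] by (auto simp: add_eq_0_iff)
    have e1: "B (?h w) = B (-1) * (B (1 + c\<^sup>2 * w) / (B (c\<^sup>2) * B (1 + w)))"
      by (simp only: mult_char_minus[OF B, of "_ / _"] mult_char_mult[OF B] mult_char_divide[OF B])
    have e2: "B (1 + ?h w) = B (-1) * (B u / (B (c\<^sup>2) * B (1 + w)))"
      unfolding h(1)[OF w]
      by (simp only: mult_char_minus[OF B, of "_ / _"] mult_char_mult[OF B] mult_char_divide[OF B])
    have e3: "\<phi> (1 + ?h w) = \<phi> (- u) * \<phi> (1 + w)"
    proof -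
      have "\<phi> (1 + ?h w) = \<phi> (- u) * (\<phi> (c\<^sup>2) * \<phi> (1 + w))"
        unfolding h(1)[OF w] by (simp only: minus_divide_left \<phi>_divide \<phi>_mult)
      then show ?thesis
        using c by (simp add: quad_char_square)
    qed
    have e4: "A (1 + c\<^sup>2 * ?h w) = A w * A u / A (1 + w)"
      unfolding h(2)[OF w] by (simp only: mult_char_mult[OF A] mult_char_divide[OF A])
    have nz: "B (-1) \<noteq> 0" "B (c\<^sup>2) \<noteq> 0" "B (1 + w) \<noteq> 0" "A (1 + w) \<noteq> 0" "B u \<noteq> 0" "A u \<noteq> 0"
      using mult_char_eq_0_iff[OF A] mult_char_eq_0_iff[OF B] c w' u by auto
    have "?f (?h w) = \<phi> (- u) * inverse ((A * B) u) * ?g w"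
      unfolding times_fun_apply inverse_fun_apply e1 e2 e3 e4 inverse_mult_distrib inverse_quad_char
      using nz by (simp add: divide_simps)
    then show "\<phi> (- u) * inverse ((A * B) u) * ?g (?h z) = ?f z"
      unfolding w_def[symmetric] by (simp only: z_eq[symmetric])
  qed
  also have "\<dots> = (\<Sum>z\<in>UNIV. \<phi> (- u) * inverse ((A * B) u) * ?g z)"
    by (rule sum.mono_neutral_left) (use 0 in auto)
  finally show ?thesis
    by (simp only: euler_sum_def u_def sum_distrib_left)
qed

end

text \<open>\<open>A\<close> and \<open>A * quad_char\<close> have the same square, so the
  hypothesis on \<open>A\<^sup>2\<close> makes the Gauss sum formulas available for both.\<close>

lemma times_quad_char_nontriv:
  fixes A :: "'a::{finite, field} \<Rightarrow> complex"
  assumes "mult_char A" "A\<^sup>2 \<noteq> triv_char"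
  shows "A * quad_char \<noteq> triv_char" "A \<noteq> triv_char"
proof
  assume *: "A * quad_char = triv_char"
  have "(A x)\<^sup>2 = triv_char x" for x
  proof (cases "x = 0")
    case False
    then have "A x * quad_char x = 1"
      using fun_cong[OF *, of x] by (simp add: triv_char_def)
    then have "A x = 1 \<or> A x = - 1"
      using quad_char_cases[of x] by (auto simp: minus_equation_iff)
    then show ?thesis
      using False by (auto simp: triv_char_def)
  qed (use mult_char_0[OF assms(1)] in \<open>simp add: triv_char_def\<close>)
  then show False
    using assms(2) by (simp add: fun_eq_iff)
next
  show "A \<noteq> triv_char"
  proof
    assume "A = triv_char"
    then have "A\<^sup>2 = triv_char"
      by (simp add: power2_eq_square triv_char_times)
    with assms(2) show False ..
  qed
qed

lemma inverse_fun_mult: "inverse (f * g) = inverse f * inverse g" for f g :: "'b \<Rightarrow> complex"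
  by (rule ext) simp

context odd_field_add_char
begin

text \<open>By reflection the square of the Euler sum \<open>e\<close> is a multiple of
  \<open>e * e'\<close>, and the product of the two Gegenbauer sums is a multiple of the same
  \<open>e * e'\<close>.\<close>

lemma greene_F_squared:
  assumes A: "mult_char A" and B: "mult_char B"
    and A2: "A\<^sup>2 \<noteq> triv_char" and B2: "B\<^sup>2 \<noteq> triv_char" and AB: "A * B \<noteq> triv_char"
    and c: "c \<noteq> 0" and u: "1 - c\<^sup>2 \<noteq> 0"
  shows "(greene_F [A, B] [A * B * \<phi>] (1 - c\<^sup>2))\<^sup>2 =
    \<phi> (1 - c\<^sup>2) * inverse ((A * B) (1 - c\<^sup>2)) * (A * B) 4 * (G B)\<^sup>2 * (G (A * \<phi>))\<^sup>2 /
      (q ^ 3 * G (A\<^sup>2) * G (B\<^sup>2)) * (gegenbauer_sum A B c * gegenbauer_sum (inverse A) (inverse B) c)"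
proof -
  note A\<phi> = times_quad_char_nontriv[OF A A2] and B\<phi> = times_quad_char_nontriv[OF B B2]
  define P P' where "P = gegenbauer_sum A B c" and "P' = gegenbauer_sum (inverse A) (inverse B) c"
  define e e' where "e = euler_sum A B c" and "e' = euler_sum (inverse B) (inverse A) c"
  define w where "w = \<phi> (-1)"
  have w: "w * w = 1"
    by (simp add: w_def)
  have sA: "A (-1) * A (-1) = 1" and sB: "B (-1) * B (-1) = 1"
    using mult_char_neg_1_squared A B by blast+
  have 1: "P * G (A * B) * G \<phi> = G A * G (B * \<phi>) * e"
    using gegenbauer_sum_eq_kloosterman_sum[OF A B AB c] kloosterman_sum_eq_euler_sum[OF A B A\<phi>(2) B\<phi>(1)]
    by (simp only: P_def e_def)
  have "inverse A * \<phi> \<noteq> triv_char"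
    using A\<phi>(1) inverse_triv_char[of "A * \<phi>"] by (simp only: inverse_fun_mult inverse_\<phi> not_False_eq_True)
  then have 2: "P' * G (inverse (A * B)) * G \<phi> = G (inverse B) * G (inverse (A * \<phi>)) * e'"
    using gegenbauer_sum_eq_kloosterman_sum[of "inverse A" "inverse B", OF _ _ _ c]
      kloosterman_sum_eq_euler_sum[of "inverse B" "inverse A" c]
      kloosterman_sum_commute[of "inverse A" "inverse B" c] A B AB B\<phi>(2) inverse_triv_char[of "A * B"]
      inverse_triv_char[of B]
    by (simp only: P'_def e'_def mult_char_inverse_fun inverse_fun_mult inverse_\<phi> simp_thms)
  \<comment> \<open>The extra factor completes the four Gauss sums that accompany
    \<open>e * e'\<close> to pairs: two for the duplication formula and two of a character with its
    inverse.\<close>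
  have "P * P' * (G (A * B) * G (inverse (A * B))) * (G \<phi> * G \<phi>) * ((G (A * \<phi>))\<^sup>2 * (G B)\<^sup>2) =
      (P * G (A * B) * G \<phi>) * (P' * G (inverse (A * B)) * G \<phi>) * ((G (A * \<phi>))\<^sup>2 * (G B)\<^sup>2)"
    by (simp only: mult_ac)
  also have "\<dots> = (G A * G (A * \<phi>)) * (G B * G (B * \<phi>)) * (G B * G (inverse B)) *
      (G (A * \<phi>) * G (inverse (A * \<phi>))) * (e * e')"
    unfolding 1 2 power2_eq_square by (simp only: mult_ac)
  finally have "P * P' * (A (-1) * B (-1) * q) * (w * q) * ((G (A * \<phi>))\<^sup>2 * (G B)\<^sup>2) =
      (inverse (A 4) * G (A\<^sup>2) * G \<phi>) * (inverse (B 4) * G (B\<^sup>2) * G \<phi>) * (B (-1) * q) *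
      (A (-1) * w * q) * (e * e')"
    unfolding gauss_inverse[OF mult_char_times[OF A B] AB] gauss_inverse[OF B B\<phi>(2)]
      gauss_inverse[OF mult_char_times[OF A \<phi>_char] A\<phi>(1)] gauss_quad_squared
      gauss_duplication[OF A A2] gauss_duplication[OF B B2]
    by (simp only: times_fun_apply w_def)
  also have "\<dots> = (A (-1) * B (-1) * q) * (w * q) * (inverse (A 4 * B 4) * G (A\<^sup>2) * G (B\<^sup>2) * (G \<phi> * G \<phi>) * (e * e'))"
    by (simp add: mult_ac)
  finally have *: "(A (-1) * B (-1) * q * (w * q)) * (P * P' * ((G (A * \<phi>))\<^sup>2 * (G B)\<^sup>2)) =
      (A (-1) * B (-1) * q * (w * q)) * (inverse (A 4 * B 4) * G (A\<^sup>2) * G (B\<^sup>2) * (w * q) * (e * e'))"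
    unfolding gauss_quad_squared w_def by (simp only: mult_ac)
  have "A (-1) * B (-1) * q * (w * q) \<noteq> 0"
    using w sA sB by auto
  with * have PP': "P * P' * ((G (A * \<phi>))\<^sup>2 * (G B)\<^sup>2) =
      inverse (A 4 * B 4) * G (A\<^sup>2) * G (B\<^sup>2) * (w * q) * (e * e')"
    by (metis mult_left_cancel)
  have e: "e = w * \<phi> (1 - c\<^sup>2) * inverse ((A * B) (1 - c\<^sup>2)) * e'"
    unfolding e_def e'_def w_def using euler_sum_reflect[OF A B c u] mult_char_minus[OF \<phi>_char, of "1 - c\<^sup>2"]
    by simp
  have nz: "A 4 \<noteq> 0" "B 4 \<noteq> 0"
    using mult_char_eq_0_iff[OF A] mult_char_eq_0_iff[OF B] four_neq_0 by blast+
  have nz': "G (A\<^sup>2) \<noteq> 0" "G (B\<^sup>2) \<noteq> 0"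
    using gauss_neq_0 A2 B2 A B by simp_all
  have main: "A 4 * B 4 * (G B)\<^sup>2 * (G (A * \<phi>))\<^sup>2 * (P * P') = G (A\<^sup>2) * G (B\<^sup>2) * q * (w * (e * e'))"
  proof -
    have "A 4 * B 4 * (G B)\<^sup>2 * (G (A * \<phi>))\<^sup>2 * (P * P') =
        A 4 * B 4 * (P * P' * ((G (A * \<phi>))\<^sup>2 * (G B)\<^sup>2))"
      by (simp only: mult_ac)
    also have "\<dots> = (A 4 * B 4 * inverse (A 4 * B 4)) * (G (A\<^sup>2) * G (B\<^sup>2) * q * (w * (e * e')))"
      unfolding PP' by (simp only: mult_ac)
    also have "A 4 * B 4 * inverse (A 4 * B 4) = 1"
      using nz by (intro right_inverse) simp
    finally show ?thesis
      by (simp only: mult_1)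
  qed
  have "\<phi> (1 - c\<^sup>2) * inverse ((A * B) (1 - c\<^sup>2)) * (A * B) 4 * (G B)\<^sup>2 * (G (A * \<phi>))\<^sup>2 /
      (q ^ 3 * G (A\<^sup>2) * G (B\<^sup>2)) * (P * P') =
      \<phi> (1 - c\<^sup>2) * inverse ((A * B) (1 - c\<^sup>2)) *
      (A 4 * B 4 * (G B)\<^sup>2 * (G (A * \<phi>))\<^sup>2 * (P * P')) / (q ^ 3 * G (A\<^sup>2) * G (B\<^sup>2))"
    by (simp only: times_fun_apply[of A B 4] divide_inverse mult_ac)
  also have "\<dots> = (w * \<phi> (1 - c\<^sup>2) * inverse ((A * B) (1 - c\<^sup>2)) * e') * e / q\<^sup>2"
    unfolding main using nz' by (simp add: power2_eq_square power3_eq_cube)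
  also have "\<dots> = e * e / q\<^sup>2"
    by (simp only: e[symmetric])
  also have "\<dots> = ((A * \<phi>) (-1) / q * e)\<^sup>2"
  proof -
    have "((A * \<phi>) (-1))\<^sup>2 = 1"
      using mult_char_neg_1_squared[OF mult_char_times[OF A \<phi>_char]] by (simp only: power2_eq_square)
    then show ?thesis
      by (simp only: power_mult_distrib power_divide) (simp add: power2_eq_square)
  qed
  finally show ?thesis
    unfolding P_def P'_def e_def greene_F_eq_euler_sum[OF A B u] by (rule sym)
qed

section \<open>The product of the two Gegenbauer sums as a double character sum\<close>

lemma gegenbauer_sum_mult_inverse:
  assumes A: "mult_char A" and B: "mult_char B" and A2: "A\<^sup>2 \<noteq> triv_char"
  shows "gegenbauer_sum A B c * gegenbauer_sum (inverse A) (inverse B) c =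
    (\<Sum>t\<in>UNIV. (A t)\<^sup>2 * (\<Sum>s\<in>UNIV. (A * B) (1 - 2 * c * s + s\<^sup>2) *
      inverse ((A * B) (1 - 2 * c * (t * s) + (t * s)\<^sup>2))))"
proof -
  define \<Lambda> where "\<Lambda> = A * B"
  define Q where "Q s = 1 - 2 * c * s + s\<^sup>2" for s :: 'a
  have \<Lambda>: "mult_char \<Lambda>"
    using A B by (simp add: \<Lambda>_def)
  have "gegenbauer_sum A B c * gegenbauer_sum (inverse A) (inverse B) c =
      (\<Sum>s\<in>UNIV. \<Sum>r\<in>UNIV. (A r)\<^sup>2 * inverse (\<Lambda> (Q r)) * ((inverse (A s))\<^sup>2 * \<Lambda> (Q s)))"
    unfolding gegenbauer_sum_def sum_product
    by (subst sum.swap) (simp add: \<Lambda>_def Q_def)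
  also have "\<dots> = (\<Sum>s\<in>UNIV. \<Sum>t\<in>UNIV. (A t)\<^sup>2 * (\<Lambda> (Q s) * inverse (\<Lambda> (Q (t * s)))))"
  proof (rule sum.cong[OF refl])
    fix s
    show "(\<Sum>r\<in>UNIV. (A r)\<^sup>2 * inverse (\<Lambda> (Q r)) * ((inverse (A s))\<^sup>2 * \<Lambda> (Q s))) =
        (\<Sum>t\<in>UNIV. (A t)\<^sup>2 * (\<Lambda> (Q s) * inverse (\<Lambda> (Q (t * s)))))"
    proof (cases "s = 0")
      \<comment> \<open>The substitution \<open>r = t s\<close> fails at \<open>s = 0\<close>. There
        the left side vanishes with \<open>A 0\<close>, and the right side is the complete sum of
        \<open>A\<^sup>2\<close>, which is zero as well.\<close>
      case True
      have "(\<Sum>t\<in>UNIV. (A t)\<^sup>2) = 0"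
        using sum_mult_char[of "A\<^sup>2"] A A2 by simp
      then show ?thesis
        using True by (simp add: mult_char_0[OF A] mult_char_1[OF \<Lambda>] Q_def)
    next
      case False
      show ?thesis
      proof (rule sum.reindex_bij_witness[of _ "\<lambda>t. t * s" "\<lambda>r. r / s"])
        fix r
        show "(A (r / s))\<^sup>2 * (\<Lambda> (Q s) * inverse (\<Lambda> (Q (r / s * s)))) =
            (A r)\<^sup>2 * inverse (\<Lambda> (Q r)) * ((inverse (A s))\<^sup>2 * \<Lambda> (Q s))"
        proof -
          have "A (r / s) = A r * inverse (A s)" and "r / s * s = r"
            using False by (simp_all add: mult_char_divide[OF A] divide_inverse[of "A r"])
          then show ?thesis
            by (simp only: power_mult_distrib mult_ac)
        qed
      qed (use False in auto)
    qed
  qed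
  also have "\<dots> = (\<Sum>t\<in>UNIV. (A t)\<^sup>2 * (\<Sum>s\<in>UNIV. \<Lambda> (Q s) * inverse (\<Lambda> (Q (t * s)))))"
    by (subst sum.swap) (simp only: sum_distrib_left)
  finally show ?thesis
    by (simp only: \<Lambda>_def Q_def)
qed

text \<open>Sorts the \<open>s\<close> by the value \<open>k\<close> of the quotient. A common zero
  of \<open>P\<close> and \<open>R\<close> is counted for every \<open>k\<close>, and this
  contribution vanishes with the complete sum of \<open>\<chi>\<close>.\<close>

lemma sum_mult_char_quotient:
  fixes P R :: "'a \<Rightarrow> 'a"
  assumes \<chi>: "mult_char \<chi>" "\<chi> \<noteq> triv_char"
  shows "(\<Sum>s\<in>UNIV. \<chi> (P s) * inverse (\<chi> (R s))) = (\<Sum>k\<in>UNIV. \<chi> k * of_nat (card {s. P s = k * R s}))"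
proof -
  have "(\<Sum>k\<in>UNIV. \<chi> k * of_nat (card {s. P s = k * R s})) =
      (\<Sum>k\<in>UNIV. \<Sum>s\<in>UNIV. if P s = k * R s then \<chi> k else 0)"
    by (rule sum.cong[OF refl]) (simp add: sum.If_cases mult.commute)
  also have "\<dots> = (\<Sum>s\<in>UNIV. \<Sum>k\<in>UNIV. if P s = k * R s then \<chi> k else 0)"
    by (rule sum.swap)
  also have "\<dots> = (\<Sum>s\<in>UNIV. \<chi> (P s) * inverse (\<chi> (R s)))"
  proof (rule sum.cong[OF refl])
    fix s
    show "(\<Sum>k\<in>UNIV. if P s = k * R s then \<chi> k else 0) = \<chi> (P s) * inverse (\<chi> (R s))"
    proof (cases "R s = 0")
      case True
      then show ?thesis
        using sum_mult_char[OF \<chi>] by (cases "P s = 0") (simp_all add: mult_char_0[OF \<chi>(1)])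
    next
      case False
      then have "P s = k * R s \<longleftrightarrow> k = P s / R s" for k
        by (auto simp: field_simps)
      then show ?thesis
        by (simp add: mult_char_divide[OF \<chi>(1)] divide_inverse[of "\<chi> _"])
    qed
  qed
  finally show ?thesis ..
qed

text \<open>\<open>D\<close> is a quarter of the discriminant. If \<open>k t\<^sup>2 = 1\<close>,
  the equation is linear: it has one solution where \<open>1 + \<phi> D\<close> gives 2, because
  \<open>D\<close> is then a nonzero square. For \<open>t = k = 1\<close> it is an identity with all
  of the field as solutions.\<close>

lemma of_nat_card_quadratic_ratio:
  fixes c t k :: 'a
  defines "D \<equiv> k * (1 - t)\<^sup>2 - (1 - c\<^sup>2) * (1 - k * t)\<^sup>2"
  assumes c: "c \<noteq> 0"
  shows "of_nat (card {s. 1 - 2 * c * s + s\<^sup>2 = k * (1 - 2 * c * (t * s) + (t * s)\<^sup>2)}) =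
    1 + \<phi> D - (if k * t\<^sup>2 = 1 then 1 else 0) + (if t = 1 \<and> k = 1 then q else 0)"
proof -
  define \<alpha> \<beta> \<gamma> where "\<alpha> = 1 - k * t\<^sup>2" and "\<beta> = c * (1 - k * t)" and "\<gamma> = 1 - k"
  have "(1 - 2 * c * s + s\<^sup>2 = k * (1 - 2 * c * (t * s) + (t * s)\<^sup>2)) \<longleftrightarrow> \<alpha> * s\<^sup>2 - 2 * \<beta> * s + \<gamma> = 0" for s
  proof -
    have "1 - 2 * c * s + s\<^sup>2 - k * (1 - 2 * c * (t * s) + (t * s)\<^sup>2) = \<alpha> * s\<^sup>2 - 2 * \<beta> * s + \<gamma>"
      by (simp add: \<alpha>_def \<beta>_def \<gamma>_def power2_eq_square algebra_simps)
    then show ?thesis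
      by (metis eq_iff_diff_eq_0)
  qed
  then have eq: "{s. 1 - 2 * c * s + s\<^sup>2 = k * (1 - 2 * c * (t * s) + (t * s)\<^sup>2)} = {s. \<alpha> * s\<^sup>2 - 2 * \<beta> * s + \<gamma> = 0}"
    by simp
  have D: "\<beta>\<^sup>2 - \<alpha> * \<gamma> = D"
    by (simp add: \<alpha>_def \<beta>_def \<gamma>_def D_def power2_eq_square algebra_simps)
  consider "\<alpha> \<noteq> 0" | "\<alpha> = 0" "\<beta> \<noteq> 0" | "\<alpha> = 0" "\<beta> = 0"
    by blast
  then show ?thesis
  proof cases
    case 1
    then have "k * t\<^sup>2 \<noteq> 1" and "\<not> (t = 1 \<and> k = 1)"
      by (auto simp: \<alpha>_def)
    then show ?thesis
      unfolding eq of_nat_card_quadratic_roots[OF odd 1] D by simp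
  next
    case 2
    have "2 * \<beta> \<noteq> 0"
      using 2 two_neq_0 by simp
    then have "{s. \<alpha> * s\<^sup>2 - 2 * \<beta> * s + \<gamma> = 0} = {\<gamma> / (2 * \<beta>)}"
      using 2 by (auto simp: field_simps)
    moreover have "\<phi> D = 1"
      using 2 D quad_char_square[of \<beta>] by simp
    moreover have "k * t\<^sup>2 = 1" "\<not> (t = 1 \<and> k = 1)"
      using 2 by (auto simp: \<alpha>_def \<beta>_def)
    ultimately show ?thesis
      unfolding eq by simp
  next
    case 3
    then have kt: "k * t = 1"
      using c by (simp add: \<beta>_def)
    moreover have "k * t * t = 1"
      using 3 by (simp add: \<alpha>_def power2_eq_square mult.assoc)
    ultimately have "t = 1"
      by (simp only: mult_1)
    with kt have "t = 1" "k = 1"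
      by simp_all
    then show ?thesis
      unfolding eq D[symmetric] using 3 by (simp add: q_def \<gamma>_def)
  qed
qed

text \<open>Of the four terms of the count two vanish on summation: the constant 1 because
  \<open>A * B\<close> is nontrivial, and the correction at \<open>k t\<^sup>2 = 1\<close> because
  it leaves the complete sum of \<open>1 / B\<^sup>2\<close>.\<close>

lemma gegenbauer_sum_mult_inverse_quad:
  fixes c :: 'a
  defines "D t k \<equiv> k * (1 - t)\<^sup>2 - (1 - c\<^sup>2) * (1 - k * t)\<^sup>2"
  assumes A: "mult_char A" and B: "mult_char B"
    and A2: "A\<^sup>2 \<noteq> triv_char" and B2: "B\<^sup>2 \<noteq> triv_char" and AB: "A * B \<noteq> triv_char" and c: "c \<noteq> 0"
  shows "gegenbauer_sum A B c * gegenbauer_sum (inverse A) (inverse B) c =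
    q + (\<Sum>t\<in>UNIV. \<Sum>k\<in>UNIV. (A t)\<^sup>2 * (A * B) k * \<phi> (D t k))"
proof -
  define \<Lambda> where "\<Lambda> = A * B"
  have \<Lambda>: "mult_char \<Lambda>" "\<Lambda> \<noteq> triv_char"
    using A B AB by (simp_all add: \<Lambda>_def)
  have H: "(A t)\<^sup>2 * (\<Sum>s\<in>UNIV. \<Lambda> (1 - 2 * c * s + s\<^sup>2) * inverse (\<Lambda> (1 - 2 * c * (t * s) + (t * s)\<^sup>2))) =
      (\<Sum>k\<in>UNIV. (A t)\<^sup>2 * \<Lambda> k * \<phi> (D t k)) - inverse ((B\<^sup>2) t) + (if t = 1 then q else 0)" for t
  proof (cases "t = 0")
    case True
    then show ?thesis
      by (simp add: mult_char_0[OF A] mult_char_0[OF B])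
  next
    case False
    have "(\<Sum>s\<in>UNIV. \<Lambda> (1 - 2 * c * s + s\<^sup>2) * inverse (\<Lambda> (1 - 2 * c * (t * s) + (t * s)\<^sup>2))) =
        (\<Sum>k\<in>UNIV. \<Lambda> k * (1 + \<phi> (D t k) - (if k * t\<^sup>2 = 1 then 1 else 0) + (if t = 1 \<and> k = 1 then q else 0)))"
      unfolding sum_mult_char_quotient[OF \<Lambda>] of_nat_card_quadratic_ratio[OF c] D_def ..
    also have "\<dots> = (\<Sum>k\<in>UNIV. \<Lambda> k) + (\<Sum>k\<in>UNIV. \<Lambda> k * \<phi> (D t k)) -
        (\<Sum>k\<in>UNIV. if k = inverse (t\<^sup>2) then \<Lambda> k else 0) + (\<Sum>k\<in>(UNIV :: 'a set). if k = 1 then (if t = 1 then q else 0) else 0)"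
      unfolding sum.distrib[symmetric] sum_subtractf[symmetric]
    proof (intro sum.cong refl)
      fix k
      have "k * t\<^sup>2 = 1 \<longleftrightarrow> k = inverse (t\<^sup>2)"
        using False by (auto simp: field_simps)
      then show "\<Lambda> k * (1 + \<phi> (D t k) - (if k * t\<^sup>2 = 1 then 1 else 0) + (if t = 1 \<and> k = 1 then q else 0)) =
          \<Lambda> k + \<Lambda> k * \<phi> (D t k) - (if k = inverse (t\<^sup>2) then \<Lambda> k else 0) + (if k = 1 then if t = 1 then q else 0 else 0)"
        by (auto simp: algebra_simps mult_char_1[OF \<Lambda>(1)])
    qed
    also have "\<dots> = (\<Sum>k\<in>UNIV. \<Lambda> k * \<phi> (D t k)) - \<Lambda> (inverse (t\<^sup>2)) + (if t = 1 then q else 0)"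
      by (simp add: sum_mult_char[OF \<Lambda>])
    finally have eq: "(\<Sum>s\<in>UNIV. \<Lambda> (1 - 2 * c * s + s\<^sup>2) * inverse (\<Lambda> (1 - 2 * c * (t * s) + (t * s)\<^sup>2))) = \<dots>" .
    have "(A t)\<^sup>2 * (if t = 1 then q else 0) = (if t = 1 then q else 0)"
      by (simp add: mult_char_1[OF A])
    then have "(A t)\<^sup>2 * (\<Sum>s\<in>UNIV. \<Lambda> (1 - 2 * c * s + s\<^sup>2) * inverse (\<Lambda> (1 - 2 * c * (t * s) + (t * s)\<^sup>2))) =
        (\<Sum>k\<in>UNIV. (A t)\<^sup>2 * \<Lambda> k * \<phi> (D t k)) - (A t)\<^sup>2 * \<Lambda> (inverse (t\<^sup>2)) + (if t = 1 then q else 0)"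
      unfolding eq distrib_left right_diff_distrib sum_distrib_left by (simp only: mult.assoc)
    moreover have "(A t)\<^sup>2 * \<Lambda> (inverse (t\<^sup>2)) = inverse ((B\<^sup>2) t)"
    proof -
      have "A t \<noteq> 0"
        using False mult_char_eq_0_iff[OF A] by blast
      then show ?thesis
        by (simp add: \<Lambda>_def mult_char_inverse[OF A] mult_char_inverse[OF B] mult_char_power[OF A] mult_char_power[OF B])
    qed
    ultimately show ?thesis
      by (simp only:)
  qed
  have B0: "(\<Sum>t\<in>UNIV. inverse ((B\<^sup>2) t)) = 0"
    using sum_mult_char[OF mult_char_inverse_fun[OF mult_char_power2[OF B]]] inverse_triv_char[of "B\<^sup>2"] B2
    by (simp only: inverse_fun_apply simp_thms)
  show ?thesis
    unfolding gegenbauer_sum_mult_inverse[OF A B A2] \<Lambda>_def[symmetric] H sum.distrib sum_subtractf B0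
    by simp
qed

text \<open>
  The change of variables \<open>k = y u z\<^sup>2\<close>, \<open>t = (1 - z) / (k - z)\<close> identifies the generic terms of
  the two double sums; the terms outside its domain are evaluated separately.
\<close>

lemma sum_quad_eq_sum_clausen:
  fixes c :: 'a
  defines "u \<equiv> 1 - c\<^sup>2"
  defines "D t k \<equiv> k * (1 - t)\<^sup>2 - u * (1 - k * t)\<^sup>2"
  assumes A: "mult_char A" and B: "mult_char B"
    and A2: "A\<^sup>2 \<noteq> triv_char" and AB: "A * B \<noteq> triv_char"
    and AB': "A * inverse B * \<phi> \<noteq> triv_char" and c: "c \<noteq> 0" and u: "u \<noteq> 0"
  shows "(\<Sum>t\<in>UNIV. \<Sum>k\<in>UNIV. (A t)\<^sup>2 * (A * B) k * \<phi> (D t k)) =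
    (A * B) u * \<phi> u * \<phi> (-1) * (\<Sum>y\<in>UNIV. \<Sum>z\<in>UNIV.
      (A * B) y * \<phi> (1 - y) * ((B z)\<^sup>2 * (A (1 - z))\<^sup>2) * inverse ((A (1 - u * y * z))\<^sup>2))"
proof -
  define \<Lambda> where "\<Lambda> = A * B"
  have \<Lambda>: "mult_char \<Lambda>" "\<Lambda> \<noteq> triv_char"
    using A B AB by (simp_all add: \<Lambda>_def)
  note 0 = mult_char_0[OF A] mult_char_0[OF B] mult_char_0[OF \<Lambda>(1)]
  note one = mult_char_1[OF A] mult_char_1[OF B] mult_char_1[OF \<Lambda>(1)]
  define f where "f t k = (A t)\<^sup>2 * \<Lambda> k * \<phi> (D t k)" for t k
  define g where "g z y = \<Lambda> u * \<phi> u * \<phi> (-1) *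
    (\<Lambda> y * \<phi> (1 - y) * ((B z)\<^sup>2 * (A (1 - z))\<^sup>2) * inverse ((A (1 - u * y * z))\<^sup>2))" for z y
  have minus_two: "(\<Sum>x\<in>-{0, 1}. h x) = (\<Sum>x\<in>UNIV. h x) - h 0 - h 1" for h :: "'a \<Rightarrow> complex"
  proof -
    have "(\<Sum>x\<in>UNIV. h x) = h 0 + (h 1 + (\<Sum>x\<in>UNIV - {0} - {1}. h x))"
      by (subst sum.remove[of UNIV 0], simp, simp, subst sum.remove[of _ 1]) auto
    moreover have "UNIV - {0} - {1} = - {0, 1 :: 'a}"
      by auto
    ultimately show ?thesis
      by (simp only:) simp
  qed
  have f_1: "(\<Sum>k\<in>UNIV. f 1 k) = - \<phi> (- u)"
  proof -
    have "f 1 k = \<phi> (- u) * \<Lambda> k - (if k = 1 then \<phi> (- u) else 0)" for k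
    proof (cases "k = 1")
      case False
      have "\<phi> (D 1 k) = \<phi> (- u * (1 - k)\<^sup>2)"
        by (simp add: D_def)
      also have "\<dots> = \<phi> (- u)"
        by (rule quad_char_mult_square[OF odd]) (use False in auto)
      finally show ?thesis
        using False by (simp add: f_def one)
    qed (simp add: f_def D_def one)
    then show ?thesis
      using sum_mult_char[OF \<Lambda>] by (simp add: sum_subtractf flip: sum_distrib_left)
  qed
  \<comment> \<open>At \<open>k = 1\<close> and \<open>k = 1 / t\<close> the new variable
    \<open>z = (1 - k t) / (1 - t)\<close> takes the values 1 and 0, where the map cannot be
    inverted. There \<open>D t k\<close> is a square, respectively \<open>t\<close> times a
    square.\<close>
  have f_generic: "(\<Sum>k\<in>UNIV. f t k) =
      (\<Sum>k\<in>-{0, 1, 1 / t}. f t k) + ((A\<^sup>2) t + (A * inverse B * \<phi>) t)" if t: "t \<in> - {0, 1}" for t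
  proof -
    have "f t 0 = 0"
      by (simp add: f_def 0)
    moreover have "f t 1 = (A\<^sup>2) t"
    proof -
      have "D t 1 = (c * (1 - t))\<^sup>2"
        by (simp add: D_def u_def power2_eq_square algebra_simps)
      then have "\<phi> (D t 1) = 1"
        using c t by (simp only: quad_char_square) (simp add: quad_char_square)
      then show ?thesis
        by (simp add: f_def one)
    qed
    moreover have "f t (1 / t) = (A * inverse B * \<phi>) t"
    proof -
      have "D t (1 / t) = t * ((1 - t) / t)\<^sup>2"
        using t by (simp add: D_def power2_eq_square)
      then have "\<phi> (D t (1 / t)) = \<phi> t"
        using t quad_char_mult_square[OF odd, of "(1 - t) / t" t] by simp
      moreover have "A t \<noteq> 0"
        using t mult_char_eq_0_iff[OF A] by auto
      ultimately show ?thesis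
        by (simp add: f_def \<Lambda>_def mult_char_inverse[OF A] mult_char_inverse[OF B] power2_eq_square divide_inverse)
    qed
    moreover have "(\<Sum>k\<in>UNIV. f t k) = f t 0 + (f t 1 + (f t (1 / t) + (\<Sum>k\<in>UNIV - {0} - {1} - {1 / t}. f t k)))"
      using t by (subst sum.remove[of UNIV 0], simp, simp, subst sum.remove[of _ 1], simp, simp,
        subst sum.remove[of _ "1 / t"]) (auto simp: divide_simps)
    moreover have "UNIV - {0} - {1} - {1 / t} = - {0, 1, 1 / t}"
      by auto
    ultimately show ?thesis
      by (simp only:) simp
  qed
  have "(\<Sum>t\<in>UNIV. \<Sum>k\<in>UNIV. f t k) = (\<Sum>t\<in>-{0, 1}. \<Sum>k\<in>UNIV. f t k) - \<phi> (- u)"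
    unfolding minus_two f_1 by (simp add: f_def 0)
  \<comment> \<open>Each of the two characters sums to -1 once \<open>t = 1\<close> is left out;
    this uses the hypothesis on \<open>A * inverse B * \<phi>\<close>.\<close>
  also have "(\<Sum>t\<in>-{0, 1}. \<Sum>k\<in>UNIV. f t k) = (\<Sum>t\<in>-{0, 1}. \<Sum>k\<in>-{0, 1, 1 / t}. f t k) - 2"
  proof -
    have "(\<Sum>t\<in>-{0, 1}. (A\<^sup>2) t) = - 1"
      unfolding minus_two sum_mult_char[OF mult_char_power2[OF A] A2] by (simp add: 0 one)
    moreover have "(\<Sum>t\<in>-{0, 1}. (A * inverse B * \<phi>) t) = - 1"
    proof -
      have \<chi>: "mult_char (A * inverse B * \<phi>)"
        using A B by simp
      show ?thesis
        unfolding minus_two sum_mult_char[OF \<chi> AB'] mult_char_0[OF \<chi>] mult_char_1[OF \<chi>] by simp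
    qed
    ultimately show ?thesis
      by (simp add: f_generic sum.distrib del: times_fun_apply power2_fun_apply)
  qed
  finally have f_sum: "(\<Sum>t\<in>UNIV. \<Sum>k\<in>UNIV. f t k) =
      (\<Sum>t\<in>-{0, 1}. \<Sum>k\<in>-{0, 1, 1 / t}. f t k) - 2 - \<phi> (- u)" .

  \<comment> \<open>For \<open>u y z = 1\<close> the inverse map has the denominator
    \<open>k - z = 0\<close>; the summand is zero there by \<open>inverse 0 = 0\<close>. The value
    \<open>u y z\<^sup>2 = 1\<close> means \<open>k = 1\<close>, which also forces
    \<open>t = 1\<close>.\<close>
  have g_generic: "(\<Sum>y\<in>UNIV. g z y) =
      (\<Sum>y\<in>-{0, 1 / (u * z), 1 / (u * z\<^sup>2)}. g z y) + \<phi> (1 - u * z\<^sup>2)" if z: "z \<in> - {0, 1}" for z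
  proof -
    have "g z 0 = 0" "g z (1 / (u * z)) = 0"
      using z u by (simp_all add: g_def 0)
    moreover have "g z (1 / (u * z\<^sup>2)) = \<phi> (1 - u * z\<^sup>2)"
    proof -
      let ?y = "1 / (u * z\<^sup>2)"
      have nz: "A u \<noteq> 0" "B u \<noteq> 0" "A z \<noteq> 0" "B z \<noteq> 0" "A (1 - z) \<noteq> 0" "A (-1) \<noteq> 0"
        using z u mult_char_eq_0_iff[OF A] mult_char_eq_0_iff[OF B] by auto
      have "1 - ?y = - 1 * (1 - u * z\<^sup>2) / (u * z\<^sup>2)"
        using z u by (simp add: divide_simps)
      then have "\<phi> (1 - ?y) = \<phi> (-1) * \<phi> (1 - u * z\<^sup>2) * (\<phi> u * \<phi> (z\<^sup>2))"
        by (simp only: \<phi>_mult \<phi>_divide)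
      also have "\<phi> (z\<^sup>2) = 1"
        using z by (simp add: quad_char_square)
      finally have 1: "\<phi> (1 - ?y) = \<phi> (-1) * \<phi> u * \<phi> (1 - u * z\<^sup>2)"
        by simp
      have "1 - u * ?y * z = - 1 * (1 - z) / z"
        using z u by (simp add: divide_simps power2_eq_square)
      then have 2: "(A (1 - u * ?y * z))\<^sup>2 = (A (1 - z))\<^sup>2 / (A z)\<^sup>2"
        using mult_char_neg_1_squared[OF A]
        by (simp only: mult_char_mult[OF A] mult_char_divide[OF A] power_mult_distrib power_divide)
           (simp add: power2_eq_square)
      have 3: "\<Lambda> ?y = inverse (A u) * inverse (B u) * inverse ((A z)\<^sup>2) * inverse ((B z)\<^sup>2)"
        by (simp add: \<Lambda>_def mult_char_inverse[OF A] mult_char_inverse[OF B] mult_char_mult[OF A]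
          mult_char_mult[OF B] mult_char_power[OF A] mult_char_power[OF B] divide_inverse)
      have sq: "\<phi> u * \<phi> u = 1" "\<phi> (-1) * (\<phi> (-1) * x) = x" for x
        using u by (simp_all flip: mult.assoc)
      have "g z ?y = (\<phi> u * \<phi> u) * (\<phi> (-1) * \<phi> (-1)) * \<phi> (1 - u * z\<^sup>2)"
        unfolding g_def 1 2 3 using nz by (simp add: \<Lambda>_def sq divide_simps)
      then show ?thesis
        using u by simp
    qed
    moreover have "(\<Sum>y\<in>UNIV. g z y) = g z 0 + (g z (1 / (u * z)) + (g z (1 / (u * z\<^sup>2)) +
        (\<Sum>y\<in>UNIV - {0} - {1 / (u * z)} - {1 / (u * z\<^sup>2)}. g z y)))"
      using z u by (subst sum.remove[of UNIV 0], simp, simp, subst sum.remove[of _ "1 / (u * z)"], simp, simp,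
        subst sum.remove[of _ "1 / (u * z\<^sup>2)"]) (auto simp: divide_simps power2_eq_square)
    moreover have "UNIV - {0} - {1 / (u * z)} - {1 / (u * z\<^sup>2)} = - {0, 1 / (u * z), 1 / (u * z\<^sup>2)}"
      by auto
    ultimately show ?thesis
      by (simp only:) simp
  qed
  have "(\<Sum>z\<in>UNIV. \<Sum>y\<in>UNIV. g z y) = (\<Sum>z\<in>-{0, 1}. \<Sum>y\<in>UNIV. g z y)"
    unfolding minus_two by (simp add: g_def 0)
  also have "\<dots> = (\<Sum>z\<in>-{0, 1}. \<Sum>y\<in>-{0, 1 / (u * z), 1 / (u * z\<^sup>2)}. g z y) +
      (\<Sum>z\<in>-{0, 1}. \<phi> (1 - u * z\<^sup>2))"
    by (simp add: g_generic sum.distrib)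
  \<comment> \<open>The omitted terms are both 1, at \<open>z = 1\<close> because
    \<open>1 - u = c\<^sup>2\<close>. The total equals the exceptional contribution in
    \<open>f_sum\<close>.\<close>
  also have "(\<Sum>z\<in>-{0, 1}. \<phi> (1 - u * z\<^sup>2)) = - 2 - \<phi> (- u)"
  proof -
    have "\<phi> (1 - u) = 1" "\<phi> 1 = 1"
      using c mult_char_1[OF \<phi>_char] by (simp_all add: u_def quad_char_square)
    then show ?thesis
      unfolding minus_two sum_quad_char_1_minus_square[OF odd u] by simp
  qed
  finally have g_sum: "(\<Sum>z\<in>UNIV. \<Sum>y\<in>UNIV. g z y) =
      (\<Sum>z\<in>-{0, 1}. \<Sum>y\<in>-{0, 1 / (u * z), 1 / (u * z\<^sup>2)}. g z y) - 2 - \<phi> (- u)"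
    by simp

  define S T where "S = (SIGMA t:-{0, 1 :: 'a}. -{0, 1, 1 / t})"
    and "T = (SIGMA z:-{0, 1 :: 'a}. -{0, 1 / (u * z), 1 / (u * z\<^sup>2)})"
  \<comment> \<open>Dividing \<open>D t k\<close> by \<open>(1 - t)\<^sup>2\<close> leaves
    \<open>k - u z\<^sup>2\<close>, so \<open>y = k / (u z\<^sup>2)\<close> turns \<open>D\<close>
    into \<open>u (y - 1)\<close> times a square. Solving for \<open>t\<close> gives
    \<open>i\<close>, and the denominator \<open>k - z = - z (1 - u y z)\<close> supplies the last
    factor of \<open>g\<close>.\<close>
  define j where "j = (\<lambda>(t, k). let z = (1 - k * t) / (1 - t) in (z, k / (u * z\<^sup>2)))"
  define i where "i = (\<lambda>(z, y). let k = u * y * z\<^sup>2 in ((1 - z) / (k - z), k))"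
  have ST: "i (j a) = a \<and> j a \<in> T \<and> (case j a of (z, y) \<Rightarrow> g z y) = (case a of (t, k) \<Rightarrow> f t k)"
    if "a \<in> S" for a
  proof -
    obtain t k where a: "a = (t, k)" by force
    have t: "t \<noteq> 0" "1 - t \<noteq> 0" and k: "k \<noteq> 0" "k - 1 \<noteq> 0" and kt: "1 - k * t \<noteq> 0"
      using that by (auto simp: a S_def divide_simps)
    define z y where "z = (1 - k * t) / (1 - t)" and "y = k / (u * z\<^sup>2)"
    have ja: "j a = (z, y)"
      by (simp add: a j_def z_def y_def Let_def)
    have z: "z \<noteq> 0"
      using t kt by (simp add: z_def)
    have y: "y \<noteq> 0" and k_eq: "u * y * z\<^sup>2 = k"
      using z u k by (simp_all add: y_def)
    have kz: "1 - k * t = z * (1 - t)"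
      using t by (simp add: z_def)
    have z1: "1 - z = t * (k - 1) / (1 - t)" and kz1: "k - z = (k - 1) / (1 - t)"
      using t by (simp_all add: z_def divide_simps) (simp_all add: algebra_simps)
    have nz: "1 - z \<noteq> 0" "k - z \<noteq> 0"
      unfolding z1 kz1 using t k by simp_all
    have t_eq: "t = (1 - z) / (k - z)"
      unfolding z1 kz1 using t k by simp
    have "i (j a) = a"
      by (simp add: a ja[unfolded a] i_def Let_def k_eq t_eq[symmetric])
    moreover have "(z, y) \<in> T"
    proof -
      have "u * y * z \<noteq> 1"
      proof
        assume "u * y * z = 1"
        then have "u * y * z\<^sup>2 = z"
          by (simp add: power2_eq_square flip: mult.assoc)
        then show False
          using nz k_eq by simp
      qed
      moreover have "u * y * z\<^sup>2 \<noteq> 1"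
        using k_eq k by simp
      ultimately show ?thesis
        using z y nz u by (auto simp: T_def)
    qed
    moreover have "g z y = f t k"
    proof -
      have "k - z = - 1 * (z * (1 - u * y * z))"
        unfolding k_eq[symmetric] by (simp add: power2_eq_square algebra_simps)
      then have "(A (k - z))\<^sup>2 = (A z)\<^sup>2 * (A (1 - u * y * z))\<^sup>2" and "A (1 - u * y * z) \<noteq> 0"
        using mult_char_neg_1_squared[OF A] mult_char_eq_0_iff[OF A] nz(2)
        by (simp_all only: mult_char_mult[OF A] power_mult_distrib) (auto simp: power2_eq_square)
      then have At: "(A t)\<^sup>2 = (A (1 - z))\<^sup>2 / ((A z)\<^sup>2 * (A (1 - u * y * z))\<^sup>2)"
        by (subst t_eq) (simp only: mult_char_divide[OF A] power_divide)
      have \<Lambda>k: "\<Lambda> k = \<Lambda> u * \<Lambda> y * ((A z)\<^sup>2 * (B z)\<^sup>2)"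
        unfolding k_eq[symmetric] mult_char_mult[OF \<Lambda>(1)] mult_char_power[OF \<Lambda>(1)]
        by (simp add: \<Lambda>_def power_mult_distrib)
      have "D t k = u * (- 1) * (1 - y) * z\<^sup>2 * (1 - t)\<^sup>2"
        unfolding D_def kz unfolding k_eq[symmetric] by (simp add: power2_eq_square algebra_simps)
      then have "\<phi> (D t k) = \<phi> (u * (- 1) * (1 - y))"
        using quad_char_mult_square[OF odd] t(2) z by (simp only: not_False_eq_True)
      then have \<phi>D: "\<phi> (D t k) = \<phi> u * \<phi> (-1) * \<phi> (1 - y)"
        by (simp only: \<phi>_mult)
      have "A z \<noteq> 0"
        using z mult_char_eq_0_iff[OF A] by blast
      then show ?thesis
        unfolding f_def g_def At \<Lambda>k \<phi>D by (simp add: divide_inverse)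
    qed
    ultimately show ?thesis
      using ja by (simp add: a)
  qed
  have TS: "j (i b) = b \<and> i b \<in> S" if "b \<in> T" for b
  proof -
    obtain z y where b: "b = (z, y)" by force
    define k t where "k = u * y * z\<^sup>2" and "t = (1 - z) / (k - z)"
    have z: "z \<noteq> 0" "1 - z \<noteq> 0" and y: "y \<noteq> 0" and uyz: "u * y * z \<noteq> 1" and k1: "k - 1 \<noteq> 0"
      using that u by (auto simp: b T_def k_def divide_simps mult_ac)
    have ib: "i b = (t, k)"
      by (simp add: b i_def Let_def k_def t_def)
    have "k - z = z * (u * y * z - 1)"
      by (simp add: k_def power2_eq_square algebra_simps)
    then have kz: "k - z \<noteq> 0"
      using z uyz by simp
    have k: "k \<noteq> 0"
      using z y u by (simp add: k_def)
    have t: "t \<noteq> 0"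
      using z kz by (simp add: t_def)
    have t1: "1 - t = (k - 1) / (k - z)" and kt: "1 - k * t = z * (k - 1) / (k - z)"
      using kz by (simp_all add: t_def divide_simps) (simp_all add: algebra_simps)
    have "(1 - k * t) / (1 - t) = z"
      unfolding t1 kt using kz k1 by simp
    then have "j (i b) = b"
      using z u by (simp add: b ib[unfolded b] j_def Let_def) (simp add: k_def)
    moreover have "1 - t \<noteq> 0" "1 - k * t \<noteq> 0"
      unfolding t1 kt using kz k1 z by simp_all
    then have "(t, k) \<in> S"
      using t k k1 by (auto simp: S_def)
    ultimately show ?thesis
      by (simp add: ib)
  qed
  have "(\<Sum>t\<in>-{0, 1}. \<Sum>k\<in>-{0, 1, 1 / t}. f t k) = (\<Sum>(t, k)\<in>S. f t k)"
    unfolding S_def by (rule sum.Sigma) auto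
  also have "\<dots> = (\<Sum>(z, y)\<in>T. g z y)"
    by (rule sum.reindex_bij_witness[of _ i j]) (use ST TS in blast)+
  also have "\<dots> = (\<Sum>z\<in>-{0, 1}. \<Sum>y\<in>-{0, 1 / (u * z), 1 / (u * z\<^sup>2)}. g z y)"
    unfolding T_def by (rule sum.Sigma[symmetric]) auto
  finally have "(\<Sum>t\<in>UNIV. \<Sum>k\<in>UNIV. f t k) = (\<Sum>z\<in>UNIV. \<Sum>y\<in>UNIV. g z y)"
    unfolding f_sum g_sum by (simp only:)
  also have "\<dots> = (\<Sum>y\<in>UNIV. \<Sum>z\<in>UNIV. g z y)"
    by (rule sum.swap)
  finally show ?thesis
    unfolding f_def g_def by (simp only: \<Lambda>_def sum_distrib_left)
qed

end

section \<open>The trace character\<close>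

lemma CHAR_eq_of_card_prime_power:
  assumes "prime p" "CARD('a::{finite, field}) = p ^ r"
  shows "CHAR('a) = p"
proof -
  have "prime CHAR('a)"
    by (rule prime_CHAR_semidom) (simp add: finite_imp_CHAR_pos)
  moreover have "CHAR('a) dvd p ^ r"
    using CHAR_dvd_CARD[where 'a = 'a] assms(2) by simp
  ultimately show ?thesis
    using assms(1) prime_dvd_power primes_dvd_imp_eq by blast
qed

lemma finite_field_power_card:
  fixes x :: "'a::{finite, field}"
  shows "x ^ CARD('a) = x"
proof (cases "x = 0")
  case False
  have "x ^ CARD('a) = x ^ (CARD('a) - 1) * x"
    using card_field_gt_1[where 'a = 'a] by (simp flip: power_Suc2)
  then show ?thesis
    using finite_field_power_card_minus_1[OF False] by simp
qed (use card_field_gt_1[where 'a = 'a] in simp)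

context
  fixes p r :: nat and \<zeta> :: complex
  assumes p: "prime p" and card: "CARD('a::{finite, field}) = p ^ r"
begin

text \<open>The Frobenius map shifts the conjugates cyclically, since
  \<open>x ^ (p ^ r) = x\<close>.\<close>

lemma trace_prime_power: "trace_prime p r (x :: 'a) ^ p = trace_prime p r x"
proof -
  have char: "CHAR('a) = p"
    using CHAR_eq_of_card_prime_power[OF p card] .
  have "trace_prime p r x ^ p = (\<Sum>i<r. x ^ (p ^ Suc i))"
    unfolding trace_prime_def
    by (subst freshmans_dream_sum) (use p char in \<open>simp_all add: mult.commute flip: power_mult\<close>)
  moreover have "x ^ (p ^ 0) + (\<Sum>i<r. x ^ (p ^ Suc i)) = (\<Sum>i<r. x ^ (p ^ i)) + x ^ (p ^ r)"
    using sum.lessThan_Suc_shift[of "\<lambda>i. x ^ (p ^ i)" r] sum.lessThan_Suc[of "\<lambda>i. x ^ (p ^ i)" r]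
    by (simp only:)
  ultimately show ?thesis
    unfolding card[symmetric] finite_field_power_card by (simp add: trace_prime_def)
qed

text \<open>The polynomial \<open>X^p - X\<close> has at most \<open>p\<close> roots, and the
  \<open>p\<close> distinct images of \<open>0, ..., p - 1\<close> are already roots.\<close>

lemma prime_subfield_eq:
  fixes x :: 'a
  assumes "x ^ p = x"
  obtains n where "n < p" "x = of_nat n"
proof -
  have char: "CHAR('a) = p"
    using CHAR_eq_of_card_prime_power[OF p card] .
  define f :: "'a poly" where "f = monom 1 p - monom 1 1"
  have p1: "p > 1"
    using p prime_gt_1_nat by blast
  have "coeff f p = 1"
    using p1 by (simp add: f_def)
  then have "f \<noteq> 0"
    by auto
  moreover have "degree f \<le> p"
    unfolding f_def using p1 by (intro degree_diff_le) (auto intro: order.trans[OF degree_monom_le])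
  ultimately have "card {x. poly f x = 0} \<le> p"
    using card_poly_roots_bound order.trans by blast
  moreover have roots: "{x. poly f x = 0} = {x. x ^ p = x}"
    by (simp add: f_def poly_monom)
  moreover have "(of_nat n :: 'a) ^ p = of_nat n" for n
  proof -
    have "(\<Sum>i<n. 1 :: 'a) ^ p = (\<Sum>i<n. 1 ^ p)"
      by (rule freshmans_dream_sum) (use p char in simp_all)
    then show ?thesis by simp
  qed
  then have "of_nat ` {..<p} \<subseteq> {x :: 'a. x ^ p = x}"
    by auto
  moreover have "card (of_nat ` {..<p} :: 'a set) = p"
    by (subst card_image) (auto simp: inj_on_def of_nat_eq_iff_cong_CHAR char cong_def)
  ultimately have "of_nat ` {..<p} = {x :: 'a. x ^ p = x}"
    by (intro card_seteq) auto
  then show thesis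
    using assms that by blast
qed

text \<open>Replaces the representative chosen by \<open>THE\<close> by an arbitrary one, so that
  additivity needs no reduction modulo \<open>p\<close>.\<close>

lemma add_char_eq_power:
  assumes "\<zeta> ^ p = 1" "of_nat n = trace_prime p r (x :: 'a)"
  shows "add_char p r \<zeta> x = \<zeta> ^ n"
proof -
  have char: "CHAR('a) = p"
    using CHAR_eq_of_card_prime_power[OF p card] .
  have "(THE m. m < p \<and> of_nat m = trace_prime p r x) = n mod p"
    using p by (intro the_equality)
      (auto simp: assms(2)[symmetric] of_nat_eq_iff_cong_CHAR char cong_def prime_gt_0_nat)
  moreover have "\<zeta> ^ n = (\<zeta> ^ p) ^ (n div p) * \<zeta> ^ (n mod p)"
    by (simp flip: power_mult power_add)
  ultimately show ?thesis
    by (simp add: add_char_def assms(1))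
qed

text \<open>The trace is a polynomial of degree at most \<open>p ^ (r - 1)\<close>, too small to
  vanish on the whole field; it is nonzero because its coefficient at \<open>X\<close> is 1.\<close>

lemma trace_prime_nontriv: "\<exists>x :: 'a. trace_prime p r x \<noteq> 0"
proof (rule ccontr)
  assume *: "\<not> (\<exists>x :: 'a. trace_prime p r x \<noteq> 0)"
  define f :: "'a poly" where "f = (\<Sum>i<r. monom 1 (p ^ i))"
  have p1: "p > 1"
    using p prime_gt_1_nat by blast
  have r: "r > 0"
    using card_field_gt_1[where 'a = 'a] card by (cases r) auto
  have "coeff f 1 = (\<Sum>i<r. if i = 0 then 1 else 0)"
    unfolding f_def coeff_sum using p1 by (intro sum.cong) auto
  then have "f \<noteq> 0"
    using r by auto
  moreover have "poly f x = trace_prime p r x" for x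
    by (simp add: f_def trace_prime_def poly_sum poly_monom)
  then have "{x. poly f x = 0} = UNIV"
    using * by simp
  moreover have "degree f \<le> p ^ (r - 1)"
    unfolding f_def using p1
    by (intro degree_sum_le) (auto intro!: order.trans[OF degree_monom_le] power_increasing)
  ultimately have "p ^ r \<le> p ^ (r - 1)"
    using card_poly_roots_bound[of f] card by simp
  then show False
    using p1 r by simp
qed

lemma odd_field_add_char_add_char:
  assumes "odd p" and \<zeta>: "primitive_root_of_unity p \<zeta>"
  shows "odd_field_add_char (add_char p r \<zeta> :: 'a \<Rightarrow> complex)"
proof
  have \<zeta>p: "\<zeta> ^ p = 1"
    using \<zeta> by (simp add: primitive_root_of_unity_def)
  have char: "CHAR('a) = p"
    using CHAR_eq_of_card_prime_power[OF p card] .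
  have trace: "\<exists>n<p. of_nat n = trace_prime p r x" for x :: 'a
    using prime_subfield_eq[OF trace_prime_power] by metis
  show "odd CARD('a)"
    using assms(1) card by simp
  show "add_char p r \<zeta> (x + y) = add_char p r \<zeta> x * add_char p r \<zeta> y" for x y :: 'a
  proof -
    obtain m n where mn: "of_nat m = trace_prime p r x" "of_nat n = trace_prime p r y"
      using trace by metis
    have "trace_prime p r (x + y) = trace_prime p r x + trace_prime p r y"
      using p char by (simp add: trace_prime_def sum.distrib freshmans_dream'[where 'a = 'a])
    then have "of_nat (m + n) = trace_prime p r (x + y)"
      by (simp add: mn)
    then show ?thesis
      using mn by (simp add: add_char_eq_power[OF \<zeta>p] power_add del: of_nat_add)
  qed
  have "of_nat 0 = trace_prime p r (0 :: 'a)"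
    using p by (simp add: trace_prime_def prime_gt_0_nat power_0_left)
  then show "add_char p r \<zeta> (0 :: 'a) = 1"
    using add_char_eq_power[OF \<zeta>p] by (metis power_0)
  obtain x :: 'a where "trace_prime p r x \<noteq> 0"
    using trace_prime_nontriv by blast
  moreover obtain n where "n < p" "of_nat n = trace_prime p r x"
    using trace by blast
  ultimately have "add_char p r \<zeta> x = \<zeta> ^ n" "0 < n"
    using add_char_eq_power[OF \<zeta>p] by (auto intro: Nat.gr0I)
  then show "\<exists>x :: 'a. add_char p r \<zeta> x \<noteq> 1"
    using \<zeta> \<open>n < p\<close> by (metis primitive_root_of_unity_def)
qed

end

section \<open>Clausen's formula\<close>

lemma greene_F_0: "greene_F As Bs (0 :: 'a::{finite, field}) = 0"
proof -
  have "char_binom (As ! 0 * \<chi>) \<chi> *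
      (\<Prod>i = 1..length Bs. char_binom (As ! i * \<chi>) (Bs ! (i - 1) * \<chi>)) * \<chi> (0 :: 'a) = 0"
    if "mult_char \<chi>" for \<chi>
    unfolding mult_char_0[OF that] by (rule mult_zero_right)
  then show ?thesis
    by (simp add: greene_F_def del: mult_eq_0_iff)
qed

context odd_field_add_char
begin

text \<open>The Euler integral of the \<open>\<^sub>3F\<^sub>2\<close>: the quotients of lower by
  upper parameters are \<open>(A * B * \<phi>) / (A * B) = \<phi>\<close> and
  \<open>(A\<^sup>2 * B\<^sup>2) / B\<^sup>2 = A\<^sup>2\<close>, which gives the weights at
  \<open>1 - y\<close> and \<open>1 - z\<close>.\<close>

lemma greene_F_clausen:
  fixes v :: 'a
  assumes A: "mult_char A" and B: "mult_char B" and v: "v \<noteq> 0"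
  shows "(\<Sum>y\<in>UNIV. \<Sum>z\<in>UNIV. (A * B) y * \<phi> (1 - y) * ((B z)\<^sup>2 * (A (1 - z))\<^sup>2) *
      inverse ((A (1 - v * y * z))\<^sup>2)) =
    \<phi> (-1) * q\<^sup>2 * greene_F [A\<^sup>2, B\<^sup>2, A * B] [A\<^sup>2 * B\<^sup>2, A * B * \<phi>] v" (is "?S = _")
proof -
  have cancel: "(inverse \<chi> * (\<chi> * \<psi>)) x = \<psi> x" if "mult_char \<chi>" "mult_char \<psi>" for \<chi> \<psi> and x :: 'a
    using mult_char_eq_0_iff[OF that(1)] mult_char_0[OF that(2)] by (cases "x = 0") simp_all
  have "(B\<^sup>2 * (A\<^sup>2 * B\<^sup>2) * (A * B) * (A * B * \<phi>)) (-1) = \<phi> (-1)"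
  proof -
    have "b\<^sup>2 * (a\<^sup>2 * b\<^sup>2) * (a * b) * (a * b * w) = w" if "a * a = 1" "b * b = 1" for a b w :: complex
    proof -
      have "b\<^sup>2 * (a\<^sup>2 * b\<^sup>2) * (a * b) * (a * b * w) = (a * a) * (a * a) * (b * b) * (b * b) * (b * b) * w"
        by (simp only: power2_eq_square mult_ac)
      then show ?thesis
        using that by simp
    qed
    from this[OF mult_char_neg_1_squared[OF A] mult_char_neg_1_squared[OF B]] show ?thesis
      by simp
  qed
  moreover have "mult_char (A\<^sup>2)" "mult_char (B\<^sup>2)" "mult_char (A * B)" "mult_char (A\<^sup>2 * B\<^sup>2)" "mult_char (A * B * \<phi>)"
    using A B by simp_all
  note greene_F_3_2[OF this v]
  moreover have "(inverse (A * B) * (A * B * \<phi>)) x = \<phi> x" "(inverse (B\<^sup>2) * (A\<^sup>2 * B\<^sup>2)) x = (A x)\<^sup>2" for x :: 'a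
    using cancel[of "A * B" \<phi> x] cancel[of "B\<^sup>2" "A\<^sup>2" x] A B
    by (simp_all only: mult_char_times mult_char_power2 \<phi>_char mult.commute[of "A\<^sup>2"] power2_fun_apply)
  ultimately have "greene_F [A\<^sup>2, B\<^sup>2, A * B] [A\<^sup>2 * B\<^sup>2, A * B * \<phi>] v = \<phi> (-1) / q\<^sup>2 * ?S"
    by (simp only: power2_fun_apply q_def)
  moreover have "\<phi> (-1) * (\<phi> (-1) * s) = s" for s
    by (simp flip: mult.assoc)
  ultimately show ?thesis
    by simp
qed

theorem clausen:
  fixes x :: 'a
  assumes A: "mult_char A" and B: "mult_char B"
    and A2: "A\<^sup>2 \<noteq> triv_char" and B2: "B\<^sup>2 \<noteq> triv_char"
    and AB': "A * inverse B * \<phi> \<noteq> triv_char" and AB: "A * B \<noteq> triv_char"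
    and x: "x \<noteq> 1" "x \<noteq> 1 / 2"
  shows "(greene_F [A, B] [A * B * \<phi>] (4 * x * (1 - x)))\<^sup>2 =
      (A * B) 4 * (G B)\<^sup>2 * (G (A * \<phi>))\<^sup>2 / (q * G (A\<^sup>2) * G (B\<^sup>2)) *
        greene_F [A\<^sup>2, B\<^sup>2, A * B] [A\<^sup>2 * B\<^sup>2, A * B * \<phi>] (4 * x * (1 - x)) +
      (G B)\<^sup>2 * (G (A * \<phi>))\<^sup>2 * (inverse A * inverse B * \<phi>) (x - x\<^sup>2) / (q\<^sup>2 * G (A\<^sup>2) * G (B\<^sup>2))"
proof (cases "x = 0")
  case True
  then show ?thesis
    by (simp add: greene_F_0)
next
  case False
  define c where "c = 1 - 2 * x"
  define u where "u = 1 - c\<^sup>2"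
  define F where "F = greene_F [A\<^sup>2, B\<^sup>2, A * B] [A\<^sup>2 * B\<^sup>2, A * B * \<phi>] u"
  define K where "K = (G B)\<^sup>2 * (G (A * \<phi>))\<^sup>2"
  have four: "(4 :: 'a) = 2\<^sup>2"
    by simp
  have u_eq: "4 * x * (1 - x) = u" and u_eq': "u = 4 * (x - x\<^sup>2)"
    by (simp_all add: u_def c_def power2_eq_square algebra_simps)
  have c: "c \<noteq> 0"
    using x(2) two_neq_0 by (auto simp: c_def field_simps)
  have u: "u \<noteq> 0"
    unfolding u_eq[symmetric] using False x(1) by simp
  have PP: "gegenbauer_sum A B c * gegenbauer_sum (inverse A) (inverse B) c = q + (A * B) u * \<phi> u * q\<^sup>2 * F"
  proof -
    have "\<phi> (-1) * (\<phi> (-1) * s) = s" for s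
      by (simp flip: mult.assoc)
    then show ?thesis
      unfolding gegenbauer_sum_mult_inverse_quad[OF A B A2 B2 AB c]
        sum_quad_eq_sum_clausen[OF A B A2 AB AB' c u[unfolded u_def]]
      unfolding u_def[symmetric] greene_F_clausen[OF A B u] F_def[symmetric] by (simp add: mult_ac)
  qed
  have nz: "(A * B) u \<noteq> 0" "G (A\<^sup>2) \<noteq> 0" "G (B\<^sup>2) \<noteq> 0" "\<phi> u * \<phi> u = 1"
    using mult_char_eq_0_iff[OF mult_char_times[OF A B]] u gauss_neq_0[of "A\<^sup>2"] gauss_neq_0[of "B\<^sup>2"] A B A2 B2
    by auto
  \<comment> \<open>Since \<open>u = 4 (x - x\<^sup>2)\<close> and \<open>\<phi> 4 = 1\<close>,
    passing from \<open>u\<close> to \<open>x - x\<^sup>2\<close> costs exactly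
    \<open>(A * B) 4\<close>. This is why that constant is absent from the extra summand.\<close>
  have last: "(inverse A * inverse B * \<phi>) (x - x\<^sup>2) = \<phi> u * inverse ((A * B) u) * (A * B) 4"
  proof -
    have "\<phi> u = \<phi> (x - x\<^sup>2)"
      unfolding u_eq' four \<phi>_mult unfolding quad_char_square[OF two_neq_0] by simp
    moreover have "(A * B) u = (A * B) 4 * (A * B) (x - x\<^sup>2)"
      unfolding u_eq' by (rule mult_char_mult[OF mult_char_times[OF A B]])
    moreover have "(A * B) 4 \<noteq> 0"
      using nz(1) calculation(2) by auto
    ultimately show ?thesis
      by (simp add: divide_simps)
  qed
  have "(greene_F [A, B] [A * B * \<phi>] u)\<^sup>2 =
      \<phi> u * inverse ((A * B) u) * (A * B) 4 * K / (q ^ 3 * G (A\<^sup>2) * G (B\<^sup>2)) * (q + (A * B) u * \<phi> u * q\<^sup>2 * F)"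
    using greene_F_squared[OF A B A2 B2 AB c u[unfolded u_def]]
    unfolding PP u_def[symmetric] K_def by (simp only: mult.assoc)
  also have "\<dots> = (A * B) 4 * K / (q * G (A\<^sup>2) * G (B\<^sup>2)) * F +
      K * (\<phi> u * inverse ((A * B) u) * (A * B) 4) / (q\<^sup>2 * G (A\<^sup>2) * G (B\<^sup>2))"
  proof -
    have "a * inverse b * d * k / (q ^ 3 * g * h) * (q + b * a * q\<^sup>2 * f) =
        (a * a) * (d * k / (q * g * h) * f) + k * (a * inverse b * d) / (q\<^sup>2 * g * h)"
      if "b \<noteq> 0" "g \<noteq> 0" "h \<noteq> 0" for a b d k g h f :: complex
      using that by (simp add: field_simps power2_eq_square power3_eq_cube)
    from this[OF nz(1-3), of "\<phi> u" "(A * B) 4" K F] show ?thesis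
      unfolding nz(4) mult_1 .
  qed
  finally show ?thesis
    unfolding u_eq last F_def K_def by (simp only: mult_ac)
qed

end

theorem theorem1p3:
  fixes p r q :: nat and \<zeta> :: complex
    and A B :: "'a::{finite, field} \<Rightarrow> complex" and x :: 'a
  assumes "prime p" and "odd p" and "q = p ^ r" and "CARD('a) = q"
    and "primitive_root_of_unity p \<zeta>"
    and "mult_char A" and "mult_char B"
    and "A\<^sup>2 \<noteq> triv_char" and "B\<^sup>2 \<noteq> triv_char"
    and "A * inverse B * quad_char \<noteq> triv_char"
    and "A * B \<noteq> triv_char" and "A * B * quad_char \<noteq> triv_char"
    and "x \<noteq> 1" and "x \<noteq> 1 / 2"
  shows "(greene_F [A, B] [A * B * quad_char] (4 * x * (1 - x)))\<^sup>2 =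
      (A * B) 4 * (gauss_sum p r \<zeta> B)\<^sup>2 * (gauss_sum p r \<zeta> (A * quad_char))\<^sup>2
        / (of_nat q * gauss_sum p r \<zeta> (A\<^sup>2) * gauss_sum p r \<zeta> (B\<^sup>2))
        * greene_F [A\<^sup>2, B\<^sup>2, A * B] [A\<^sup>2 * B\<^sup>2, A * B * quad_char] (4 * x * (1 - x))
    + (gauss_sum p r \<zeta> B)\<^sup>2 * (gauss_sum p r \<zeta> (A * quad_char))\<^sup>2
        * (inverse A * inverse B * quad_char) (x - x\<^sup>2)
        / ((of_nat q)\<^sup>2 * gauss_sum p r \<zeta> (A\<^sup>2) * gauss_sum p r \<zeta> (B\<^sup>2))"
proof -
  have loc: "odd_field_add_char (add_char p r \<zeta> :: 'a \<Rightarrow> complex)"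
    by (rule odd_field_add_char_add_char) (use assms in simp_all)
  have "gauss_sum p r \<zeta> = odd_field_add_char.G (add_char p r \<zeta> :: 'a \<Rightarrow> complex)"
    by (rule ext) (simp add: gauss_sum_def odd_field_add_char.G_def[OF loc])
  moreover have "of_nat q = odd_field_add_char.q TYPE('a)"
    using assms(4) by (simp add: odd_field_add_char.q_def[OF loc])
  ultimately show ?thesis
    using odd_field_add_char.clausen[OF loc] assms(6-11,13,14) by (simp only:)
qed

end
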